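(* Let $\gamma=(1+\sqrt5)/2$. For each $\underline q\in\mathcal{A}(\epsilon)=\{(q_1,q_2)\in\mathbb{R}^2: q_1\ge0,\ q_2\le q_1\}$, we have $\|\underline P(\gamma\underline q)-\gamma\underline P(\underline q)\|\le 40$.
   Context: $\|\cdot\|$ is the maximum norm. Fibonacci numbers: $F_{-1}=0$, $F_0=1$, $F_{i+2}=F_{i+1}+F_i$. Words: $E=\{a,b\}$, $E^*$ the monoid of finite words, $\epsilon$ the empty word, $|w|$ the length, $u\le w$ means $u$ is a prefix of $w$, $u<w$ means $u\le w$ and $u\ne w$. Let $w_1=a$, $w_2=ab$, $w_{i+2}=w_{i+1}w_i$, $w_\infty=\lim w_i$; prefixes of $w_\infty$ are words $v\le w_i$ for some $i$. Let $\mathcal{F}=\{\epsilon,w_1,w_2,\dots\}$. For a prefix $v$ of $w_\infty$: $\iota(v)=v$ if $v\in\mathcal{F}$; otherwise $w_i<v<w_{i+1}$ for some $i\ge3$ and $\iota(v)$ is the prefix of $w_\infty$ of length $|v|-2F_{i-2}$. Set $\alpha(v)=\lim_{k\to\infty}\iota^k(v)$ (eventually constant). For a prefix $v$ of $w_\infty$ let $P_v(q_1,q_2)=\max\{q_1-|v|,\,q_2-|\alpha(v)|,\,|v|\}$, $\mathcal{A}(v)=\{\underline q: P_v(\underline q)=q_1-|v|\}$, $\mathcal{C}(v)=\{\underline q: P_v(\underline q)=|v|\}$. Let $\Phi:\mathbb{R}^3\to\mathbb{R}^3$ sort coordinates in non-decreasing order. For $\underline q=(q_1,q_2)\in\mathcal{A}(\epsilon)$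 define $\underline P(\underline q)=\Phi(q_1-|u|,\,q_2+|u|-|w|,\,|w|)$ where $u$ is the largest prefix of $w_\infty$ with $\underline q\in\mathcal{A}(u)$, and $w$ is the smallest prefix of $w_\infty$ with $u<w$ and $\underline q\in\mathcal{C}(w)$. *)

theory Defs
  imports "HOL-Analysis.Analysis" "HOL-Library.Sublist" "HOL-Number_Theory.Fib"
begin

text \<open>The indexing convention here is \<open>F\<^sub>0 = F\<^sub>1 = 1\<close> (and \<open>F\<^sub>-\<^sub>1 = 0\<close>), one step ahead of the
  library's \<^const>\<open>fib\<close>. The term \<open>F\<^sub>-\<^sub>1\<close> is never needed below.\<close>

definition F :: "nat \<Rightarrow> nat" where
  "F i = fib (Suc i)"

datatype letter = LetA | LetB

type_synonym word = "letter list"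

text \<open>The sequence of interest is indexed from 1, with \<open>w\<^sub>1 = a\<close> and \<open>w\<^sub>2 = ab\<close>. The auxiliary value
  \<open>w\<^sub>0 = b\<close> merely extends the recursion; it is not a prefix of the infinite word, so it is
  excluded (\<open>i \<ge> 1\<close>) from the sets below.\<close>

fun fib_word :: "nat \<Rightarrow> word" where
  "fib_word 0 = [LetB]"
| "fib_word (Suc 0) = [LetA]"
| "fib_word (Suc (Suc i)) = fib_word (Suc i) @ fib_word i"

definition winf_prefixes :: "word set" where
  "winf_prefixes = {v. \<exists>i\<ge>1. prefix v (fib_word i)}"

definition fib_words :: "word set" where
  "fib_words = insert [] {fib_word i |i. i \<ge> 1}"

definition iota :: "word \<Rightarrow> word" where
  "iota v = (if v \<in> fib_words then v else
     (THE u. u \<in> winf_prefixes \<and>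
        (\<exists>i\<ge>3. strict_prefix (fib_word i) v \<and> strict_prefix v (fib_word (i + 1)) \<and>
               length u + 2 * F (i - 2) = length v)))"

text \<open>The limit is that of an eventually constant sequence of words.\<close>

definition alpha :: "word \<Rightarrow> word" where
  "alpha v = (THE u. eventually (\<lambda>k. (iota ^^ k) v = u) sequentially)"

definition P_word :: "word \<Rightarrow> real^2 \<Rightarrow> real" where
  "P_word v q = Max {q $ 1 - real (length v), q $ 2 - real (length (alpha v)), real (length v)}"

definition A_region :: "word \<Rightarrow> (real^2) set" where
  "A_region v = {q. P_word v q = q $ 1 - real (length v)}"

definition C_region :: "word \<Rightarrow> (real^2) set" where
  "C_region v = {q. P_word v q = real (length v)}"

definition Phi :: "real^3 \<Rightarrow> real^3" where
  "Phi x = vector (sort [x $ 1, x $ 2, x $ 3])"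

text \<open>Largest and smallest are with respect to the prefix order, which is total on the prefixes of
  the infinite word.\<close>

definition u_word :: "real^2 \<Rightarrow> word" where
  "u_word q = (THE u. u \<in> winf_prefixes \<and> q \<in> A_region u \<and>
     (\<forall>v\<in>winf_prefixes. q \<in> A_region v \<longrightarrow> prefix v u))"

definition w_word :: "real^2 \<Rightarrow> word" where
  "w_word q = (THE w. w \<in> winf_prefixes \<and> strict_prefix (u_word q) w \<and> q \<in> C_region w \<and>
     (\<forall>v\<in>winf_prefixes. strict_prefix (u_word q) v \<and> q \<in> C_region v \<longrightarrow> prefix w v))"

text \<open>Only meaningful for \<open>q \<in> A_region []\<close>.\<close>

definition P_map :: "real^2 \<Rightarrow> real^3" where
  "P_map q = Phi (vector [q $ 1 - real (length (u_word q)),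
                          q $ 2 + real (length (u_word q)) - real (length (w_word q)),
                          real (length (w_word q))])"

end

theory Submission
  imports Defs
begin

text \<open>A prefix of \<open>w\<^sub>\<infinity>\<close> is determined by its length, so the points \<open>u\<close> and \<open>w\<close> become
  naturals \<open>n < m\<close>, and \<open>\<iota>\<close> becomes the subtraction \<open>n \<mapsto> n - 2F\<^bsub>i-2\<^esub>\<close> for \<open>F\<^sub>i < n < F\<^bsub>i+1\<^esub>\<close>.
  Put \<open>y = F\<^bsub>i-3\<^esub>\<close> and \<open>x = F\<^bsub>i-2\<^esub>\<close>, so that \<open>F\<^sub>i = 2x+y\<close> and \<open>F\<^bsub>i+1\<^esub> = 3x+2y\<close>. The band
  \<open>2F\<^sub>i \<le> q\<^sub>1 \<le> 2F\<^bsub>i+1\<^esub>\<close> splits into four polygons on which \<open>(u, w)\<close> is constant and a fifth one,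
  \<open>q\<^sub>1 - q\<^sub>2 \<ge> 2x\<close> and \<open>q\<^sub>2 \<le> 2F\<^sub>i\<close>, on which \<open>P(q) = P(q - (4x, 2x)) + (2x, 2x, 2x)\<close>. The formulas
  agree on common boundaries, so each component of \<open>P\<close> is 1-Lipschitz for the maximum norm.
  Multiplication by \<open>\<gamma>\<close> carries each polygon to within \<open>O(\<gamma>\<^bsup>-i\<^esup>)\<close> of the corresponding polygon of the
  next band, because \<open>F\<^bsub>i+1\<^esub> - \<gamma> F\<^sub>i = (1-\<gamma>)\<^bsup>i+1\<^esup>\<close>; hence every step of the recursion adds an error
  of size \<open>O(\<gamma>\<^bsup>-i\<^esup>)\<close>, and these errors form a convergent geometric series.\<close>

section \<open>Prefixes of the infinite word\<close>

lemma F_simps [simp]: "F 0 = 1" "F (Suc 0) = 1" "F (Suc (Suc n)) = F (Suc n) + F n"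
  by (simp_all add: F_def)

lemma F_pos [simp]: "0 < F n"
  by (simp add: F_def fib_neq_0_nat)

lemma F_less_Suc: "F (Suc n) < F (Suc (Suc n))"
  by simp

lemma F_mono: "m \<le> n \<Longrightarrow> F m \<le> F n"
  by (simp add: F_def fib_mono)

lemma F_ge: "n \<le> F n"
proof (induction n rule: less_induct)
  case (less n)
  show ?case
  proof (cases "n < 2")
    case False
    then obtain m where n: "n = Suc (Suc m)"
      by (metis add_2_eq_Suc le_add_diff_inverse not_le)
    from less[of "Suc m"] show ?thesis using F_pos[of m] unfolding n F_simps by linarith
  qed (auto simp: less_2_cases_iff)
qed

lemma F_bracket:
  assumes "1 \<le> n"
  obtains i where "i \<ge> 1" "F i \<le> n" "n < F (Suc i)"
proof -
  have "\<exists>i. n < F (Suc i)"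
    using F_ge[of "Suc n"] by (intro exI[of _ n]) linarith
  then obtain i where i: "n < F (Suc i)" "\<And>k. k < i \<Longrightarrow> \<not> n < F (Suc k)"
    using exists_least_iff[of "\<lambda>i. n < F (Suc i)"] by blast
  have "i \<noteq> 0" using i(1) assms by (cases i) auto
  then obtain k where "i = Suc k" by (cases i) auto
  with i show ?thesis by (intro that[of i]) (auto simp: not_less)
qed

lemma F_gap_unique:
  assumes "F i < n" "n < F (Suc i)" "F j < n" "n < F (Suc j)"
  shows "i = j"
proof (rule ccontr)
  assume "i \<noteq> j"
  then consider "Suc i \<le> j" | "Suc j \<le> i" by linarith
  thus False using F_mono assms by (cases; fastforce)
qed

lemma length_fib_word [simp]: "length (fib_word n) = F n"
  by (induction n rule: fib_word.induct) auto

lemma fib_word_prefix: "1 \<le> i \<Longrightarrow> i \<le> j \<Longrightarrow> prefix (fib_word i) (fib_word j)"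
proof (induction j)
  case (Suc j)
  show ?case
  proof (cases "i = Suc j")
    case False
    with Suc have "prefix (fib_word i) (fib_word j)" by simp
    moreover from False Suc.prems obtain k where "j = Suc k" by (cases j) auto
    hence "prefix (fib_word j) (fib_word (Suc j))" by simp
    ultimately show ?thesis using prefix_order.trans by blast
  qed simp
qed simp

text \<open>The index \<open>Suc n\<close> is at least 1, which avoids the auxiliary word
  \<open>fib_word 0\<close>, and by \<open>F_ge\<close> that word has more than \<open>n\<close>
  letters, so \<open>take\<close> never falls short.\<close>

definition winf_prefix :: "nat \<Rightarrow> word" where
  "winf_prefix n = take n (fib_word (Suc n))"

lemma length_winf_prefix [simp]: "length (winf_prefix n) = n"
  using F_ge[of "Suc n"] by (simp add: winf_prefix_def)

lemma winf_prefix_eq_take: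
  assumes "1 \<le> i" "n \<le> F i"
  shows "winf_prefix n = take n (fib_word i)"
proof -
  have "prefix (fib_word (Suc n)) (fib_word i) \<or> prefix (fib_word i) (fib_word (Suc n))"
    using fib_word_prefix assms(1) by (metis le_add1 nat_le_linear plus_1_eq_Suc)
  thus ?thesis using assms(2) F_ge[of "Suc n"] by (auto simp: winf_prefix_def prefix_def)
qed

lemma winf_prefixes_iff: "v \<in> winf_prefixes \<longleftrightarrow> v = winf_prefix (length v)"
proof
  assume "v \<in> winf_prefixes"
  then obtain i where "i \<ge> 1" "prefix v (fib_word i)" by (auto simp: winf_prefixes_def)
  moreover from this have "length v \<le> F i" using prefix_length_le by fastforce
  ultimately show "v = winf_prefix (length v)"
    by (metis append_eq_conv_conj winf_prefix_eq_take prefix_def)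
next
  assume "v = winf_prefix (length v)"
  thus "v \<in> winf_prefixes" unfolding winf_prefixes_def winf_prefix_def
    by (metis (mono_tags, lifting) le_add1 mem_Collect_eq plus_1_eq_Suc take_is_prefix)
qed

lemma winf_prefix_in [simp]: "winf_prefix n \<in> winf_prefixes"
  by (simp add: winf_prefixes_iff)

lemma prefix_winf_prefix_iff [simp]: "prefix (winf_prefix m) (winf_prefix n) \<longleftrightarrow> m \<le> n"
proof
  assume "m \<le> n"
  hence "winf_prefix m = take m (fib_word (Suc n))" using F_ge[of "Suc n"] by (intro winf_prefix_eq_take) auto
  moreover from \<open>m \<le> n\<close> have "take m (fib_word (Suc n)) = take m (winf_prefix n)" by (simp add: winf_prefix_def)
  ultimately show "prefix (winf_prefix m) (winf_prefix n)" by (metis take_is_prefix)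
qed (metis length_winf_prefix prefix_length_le)

lemma winf_prefix_eq_iff [simp]: "winf_prefix m = winf_prefix n \<longleftrightarrow> m = n"
  by (metis length_winf_prefix)

lemma strict_prefix_winf_prefix_iff [simp]: "strict_prefix (winf_prefix m) (winf_prefix n) \<longleftrightarrow> m < n"
  by (auto simp: strict_prefix_def)

lemma winf_prefix_0 [simp]: "winf_prefix 0 = []"
  by (metis length_0_conv length_winf_prefix)

lemma fib_word_eq_winf_prefix: "i \<ge> 1 \<Longrightarrow> fib_word i = winf_prefix (F i)"
  by (metis length_fib_word order_refl winf_prefix_eq_take take_all)

section \<open>The map iota and its limit\<close>

lemma iota_fib: "i \<ge> 1 \<Longrightarrow> iota (winf_prefix (F i)) = winf_prefix (F i)"
  using fib_word_eq_winf_prefix[of i] by (auto simp: iota_def fib_words_def)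

lemma iota_0: "iota [] = []"
  by (auto simp: iota_def fib_words_def)

text \<open>The index i in the definition of \<open>iota\<close> is \<open>j + 3\<close>, so i - 2
  is \<open>j + 1\<close>. Gaps between consecutive Fibonacci numbers are disjoint, which makes i,
  and with it the word described by \<open>iota\<close>, unique.\<close>

lemma iota_gap:
  assumes "F (j + 3) < n" "n < F (j + 4)"
  shows "iota (winf_prefix n) = winf_prefix (n - 2 * F (j + 1))"
proof -
  have "winf_prefix n \<notin> fib_words"
  proof
    assume "winf_prefix n \<in> fib_words"
    then consider "n = 0" | i where "i \<ge> 1" "n = F i"
      by (auto simp: fib_words_def fib_word_eq_winf_prefix dest: arg_cong[of _ _ length])
    thus False
    proof cases
      case 2
      hence "j + 3 < i" "i < j + 4" using assms F_mono by (metis not_less)+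
      thus False by simp
    qed (use assms in auto)
  qed
  moreover have "(THE u. u \<in> winf_prefixes \<and>
        (\<exists>i\<ge>3. strict_prefix (fib_word i) (winf_prefix n) \<and> strict_prefix (winf_prefix n) (fib_word (i + 1)) \<and>
               length u + 2 * F (i - 2) = length (winf_prefix n))) = winf_prefix (n - 2 * F (j + 1))"
  proof (rule the_equality)
    \<comment> \<open>Hence the subtraction on naturals does not truncate.\<close>
    have "2 * F (j + 1) \<le> n" using assms by (simp add: numeral_eq_Suc)
    thus "winf_prefix (n - 2 * F (j + 1)) \<in> winf_prefixes \<and>
        (\<exists>i\<ge>3. strict_prefix (fib_word i) (winf_prefix n) \<and> strict_prefix (winf_prefix n) (fib_word (i + 1)) \<and>
               length (winf_prefix (n - 2 * F (j + 1))) + 2 * F (i - 2) = length (winf_prefix n))"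
      using assms by (intro conjI exI[of _ "j + 3"]) (auto simp: fib_word_eq_winf_prefix add.commute simp del: F_simps fib_word.simps)
  next
    fix u assume u: "u \<in> winf_prefixes \<and>
        (\<exists>i\<ge>3. strict_prefix (fib_word i) (winf_prefix n) \<and> strict_prefix (winf_prefix n) (fib_word (i + 1)) \<and>
               length u + 2 * F (i - 2) = length (winf_prefix n))"
    then obtain i where i: "i \<ge> 3" "strict_prefix (fib_word i) (winf_prefix n)"
      "strict_prefix (winf_prefix n) (fib_word (i + 1))" "length u + 2 * F (i - 2) = n" by auto
    hence "F i < n" "n < F (Suc i)" by (auto simp: fib_word_eq_winf_prefix simp del: F_simps fib_word.simps)
    hence "i = j + 3" using F_gap_unique assms by (simp add: numeral_eq_Suc del: F_simps)
    hence "length u = n - 2 * F (j + 1)" using i by auto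
    thus "u = winf_prefix (n - 2 * F (j + 1))" using u winf_prefixes_iff by metis
  qed
  ultimately show ?thesis unfolding iota_def by simp
qed

lemma alpha_fixed:
  assumes "iota v = v"
  shows "alpha v = v"
proof -
  have "(iota ^^ k) v = v" for k by (induction k) (auto simp: assms)
  thus ?thesis by (simp add: alpha_def)
qed

text \<open>The iterates started at \<open>iota v\<close> are those of \<open>v\<close> with the
  first one dropped, so the two sequences have the same eventual values.\<close>

lemma alpha_iota: "alpha (iota v) = alpha v"
proof -
  have "eventually (\<lambda>k. (iota ^^ k) (iota v) = u) sequentially \<longleftrightarrow>
        eventually (\<lambda>k. (iota ^^ k) v = u) sequentially" for u
    by (subst (2) eventually_sequentially_Suc[symmetric]) (simp add: funpow_swap1)
  thus ?thesis by (simp add: alpha_def)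
qed

section \<open>The length of the limit word\<close>

definition alpha_len :: "nat \<Rightarrow> nat" where
  "alpha_len n = length (alpha (winf_prefix n))"

lemma alpha_len_0 [simp]: "alpha_len 0 = 0"
  by (simp add: alpha_len_def alpha_fixed iota_0)

lemma alpha_len_F [simp]: "alpha_len (F i) = F i"
proof (cases "i = 0")
  case True
  hence "F i = F 1" by simp
  thus ?thesis using alpha_fixed[OF iota_fib[of 1]] unfolding alpha_len_def by simp
next
  case False
  thus ?thesis using alpha_fixed[OF iota_fib[of i]] unfolding alpha_len_def by simp
qed

lemma alpha_len_gap:
  assumes "F (j + 3) < n" "n < F (j + 4)"
  shows "alpha_len n = alpha_len (n - 2 * F (j + 1))"
  unfolding alpha_len_def iota_gap[OF assms, symmetric] by (simp add: alpha_iota)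

text \<open>The numbers 1, 2, 3 are all Fibonacci numbers, so a gap that contains an integer starts
  at \<open>F 3\<close> or later.\<close>

lemma alpha_len_cases:
  obtains "n = 0" | i where "n = F i" | j where "F (j + 3) < n" "n < F (j + 4)"
proof (cases "n = 0")
  case False
  then obtain i where i: "i \<ge> 1" "F i \<le> n" "n < F (Suc i)" using F_bracket[of n] by auto
  show thesis
  proof (cases "i < 3")
    case True
    with i(1) consider "i = 1" | "i = 2" by linarith
    hence "n = F i" using i by cases (auto simp: numeral_eq_Suc)
    thus ?thesis using that by blast
  next
    case False
    then obtain j where j: "i = j + 3" by (metis add.commute le_Suc_ex not_less)
    show ?thesis
    proof (cases "n = F i")
      case False
      with i that(3)[of j] show ?thesis by (simp add: j numeral_eq_Suc)
    qed (use that in blast)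
  qed
qed (use that in blast)

lemma alpha_len_le: "alpha_len n \<le> n"
proof (induction n rule: less_induct)
  case (less n)
  show ?case
  proof (cases n rule: alpha_len_cases)
    case (3 j)
    moreover from 3 have "n > 0" by simp
    ultimately have "alpha_len n \<le> n - 2 * F (j + 1)" using less[of "n - 2 * F (j + 1)"] alpha_len_gap[OF 3] F_pos[of "j+1"]
      by (metis diff_less mult_pos_pos pos2)
    thus ?thesis by simp
  qed auto
qed

text \<open>The first step of \<open>iota\<close> removes \<open>2 * F j\<close> letters and later
  steps never add any. The bound serves to exclude candidates for the length of u.\<close>

lemma delta_gap:
  assumes "F (j + 2) < n" "n < F (j + 3)"
  shows "alpha_len n + 2 * F j \<le> n"
proof (cases j)
  case 0
  with assms show ?thesis by (simp add: numeral_eq_Suc)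
next
  case (Suc k)
  have "alpha_len n = alpha_len (n - 2 * F j)" using alpha_len_gap[of k n] assms Suc by (simp add: numeral_eq_Suc)
  moreover have "2 * F j \<le> n" using assms by (simp add: Suc numeral_eq_Suc)
  ultimately show ?thesis using alpha_len_le[of "n - 2 * F j"] by linarith
qed

text \<open>Strong induction along \<open>iota\<close>. Removing \<open>2 * F (j + 1)\<close>
  reduces the claim to \<open>m + alpha_len m \<le> 2 * F (j + 2)\<close>, which either follows from
  \<open>alpha_len m \<le> m\<close> or is an earlier instance. The bound serves to exclude
  candidates for the length of w.\<close>

lemma sigma_gap:
  assumes "F i < n" "n < F (Suc i)"
  shows "n + alpha_len n \<le> 2 * F i"
  using assms
proof (induction i arbitrary: n rule: less_induct)
  case (less i)
  show ?case
  proof (cases "i < 3")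
    case True
    then consider "i = 0" | "i = 1" | "i = 2" by linarith
    thus ?thesis using less.prems by cases (auto simp: numeral_eq_Suc)
  next
    case False
    then obtain j where i: "i = j + 3" by (metis add.commute le_Suc_ex not_less)
    define m where "m = n - 2 * F (j + 1)"
    have alpha_len: "alpha_len n = alpha_len m" unfolding m_def using less.prems i by (intro alpha_len_gap) (simp_all add: numeral_eq_Suc)
    have n: "n = m + 2 * F (j + 1)" using less.prems by (simp add: i m_def numeral_eq_Suc)
    have "m + alpha_len m \<le> 2 * F (j + 2)"
    proof (cases "m \<le> F (j + 2)")
      case True
      thus ?thesis using alpha_len_le[of m] by linarith
    next
      case False
      \<comment> \<open>It bounds \<open>F (j + 4) - 2 * F (j + 1) = F (j + 1) + 2 * F j\<close> by
        \<open>F (j + 3)\<close>, so \<open>m\<close> lies in the gap just below the one of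
        \<open>n\<close>.\<close>
      moreover have "F j \<le> F (j + 1)" by (intro F_mono) simp
      hence "m < F (Suc (j + 2))" using less.prems n by (simp add: i numeral_eq_Suc)
      ultimately show ?thesis using less.IH[of "j + 2" m] i by simp
    qed
    thus ?thesis using alpha_len n by (simp add: i numeral_eq_Suc)
  qed
qed

section \<open>Components of the map on each band\<close>

definition in_A :: "real \<Rightarrow> real \<Rightarrow> nat \<Rightarrow> bool" where
  "in_A s t n \<longleftrightarrow> 2 * real n \<le> s \<and> real n - real (alpha_len n) \<le> s - t"

definition in_C :: "real \<Rightarrow> real \<Rightarrow> nat \<Rightarrow> bool" where
  "in_C s t m \<longleftrightarrow> s \<le> 2 * real m \<and> t \<le> real m + real (alpha_len m)"

text \<open>At the point with coordinates \<open>s\<close> and \<open>t\<close>, \<open>n\<close> is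
  the length of u and \<open>m\<close> the length of w.\<close>

definition state :: "real \<Rightarrow> real \<Rightarrow> nat \<Rightarrow> nat \<Rightarrow> bool" where
  "state s t n m \<longleftrightarrow> in_A s t n \<and> (\<forall>k>n. \<not> in_A s t k) \<and>
     n < m \<and> in_C s t m \<and> (\<forall>k. n < k \<and> k < m \<longrightarrow> \<not> in_C s t k)"

lemma state_exists:
  assumes "0 \<le> s" "t \<le> s"
  obtains n m where "state s t n m"
proof -
  have fin: "finite {n. in_A s t n}"
  proof (rule finite_subset)
    show "{n. in_A s t n} \<subseteq> {..nat \<lfloor>s\<rfloor>}" by (auto simp: in_A_def le_nat_floor)
  qed simp
  have "0 \<in> {n. in_A s t n}" using assms by (simp add: in_A_def)
  define n where "n = Max {n. in_A s t n}"
  have n: "in_A s t n" using Max_in[OF fin] \<open>0 \<in> _\<close> unfolding n_def by blast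
  have n': "\<not> in_A s t k" if "k > n" for k using Max_ge[OF fin, of k] that unfolding n_def by force
  define C where "C m \<longleftrightarrow> n < m \<and> in_C s t m" for m
  \<comment> \<open>Every \<open>m \<ge> s\<close> satisfies \<open>in_C\<close>, because
    \<open>0 \<le> s\<close> and \<open>t \<le> s\<close>; the summand \<open>n + 1\<close> puts the
    witness beyond \<open>n\<close>.\<close>
  have "C (n + 1 + nat \<lceil>s\<rceil>)" using assms unfolding C_def in_C_def by (simp add: algebra_simps) linarith
  then obtain m where m: "C m" "\<And>k. k < m \<Longrightarrow> \<not> C k" using exists_least_iff[of C] by blast
  have "state s t n m" unfolding state_def using n n' m by (auto simp: C_def)
  thus ?thesis by (rule that)
qed

lemma state_unique:
  assumes "state s t n m" "state s t n' m'"
  shows "n = n' \<and> m = m'"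
proof -
  have "n = n'" using assms unfolding state_def by (metis linorder_neqE_nat)
  moreover from this have "m = m'" using assms unfolding state_def by (metis linorder_neqE_nat)
  ultimately show ?thesis ..
qed

section \<open>Order statistics of three reals\<close>

definition sorted3 :: "nat \<Rightarrow> real \<Rightarrow> real \<Rightarrow> real \<Rightarrow> real" where
  "sorted3 k a b c = (if k = 0 then min a (min b c)
     else if k = 1 then max (min a b) (min (max a b) c) else max a (max b c))"

text \<open>Minimum and maximum are nonexpansive for the maximum norm, and each order statistic is
  composed of them.\<close>

lemma sorted3_lipschitz:
  assumes "\<bar>a - a'\<bar> \<le> e" "\<bar>b - b'\<bar> \<le> e" "\<bar>c - c'\<bar> \<le> e"
  shows "\<bar>sorted3 k a b c - sorted3 k a' b' c'\<bar> \<le> e"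
proof -
  have min: "\<bar>min x y - min x' y'\<bar> \<le> e" if "\<bar>x - x'\<bar> \<le> e" "\<bar>y - y'\<bar> \<le> e" for x y x' y' :: real
    using that by (auto simp: min_def)
  have max: "\<bar>max x y - max x' y'\<bar> \<le> e" if "\<bar>x - x'\<bar> \<le> e" "\<bar>y - y'\<bar> \<le> e" for x y x' y' :: real
    using that by (auto simp: max_def)
  show ?thesis unfolding sorted3_def using assms by (auto intro!: min max)
qed

lemma sorted3_add: "sorted3 k (a + d) (b + d) (c + d) = sorted3 k a b c + d"
  by (simp add: sorted3_def min_add_distrib_left max_add_distrib_left)

lemma sorted3_mult: "0 \<le> d \<Longrightarrow> sorted3 k (d * a) (d * b) (d * c) = d * sorted3 k a b c"
  by (simp add: sorted3_def min_mult_distrib_left max_mult_distrib_left)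

text \<open>On a common edge the formulas of two polygons often have the same entries in a different
  order; these transpositions match them.\<close>

lemma sorted3_perms:
  "a = a' \<Longrightarrow> b = c' \<Longrightarrow> c = b' \<Longrightarrow> sorted3 k a b c = sorted3 k a' b' c'"
  "a = b' \<Longrightarrow> b = a' \<Longrightarrow> c = c' \<Longrightarrow> sorted3 k a b c = sorted3 k a' b' c'"
  "a = c' \<Longrightarrow> b = b' \<Longrightarrow> c = a' \<Longrightarrow> sorted3 k a b c = sorted3 k a' b' c'"
  by (auto simp: sorted3_def min_def max_def)

definition P_comp :: "nat \<Rightarrow> real \<Rightarrow> real \<Rightarrow> real" where
  "P_comp k s t = (let (n, m) = (SOME (n, m). state s t n m)
     in sorted3 k (s - real n) (t + real n - real m) (real m))"

lemma P_comp_state: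
  assumes "state s t n m"
  shows "P_comp k s t = sorted3 k (s - real n) (t + real n - real m) (real m)"
proof -
  have "(SOME (n, m). state s t n m) = (n, m)"
  proof (rule some_equality)
    fix p assume "case p of (n, m) \<Rightarrow> state s t n m"
    with assms state_unique show "p = (n, m)" by (cases p) auto
  qed (use assms in simp)
  thus ?thesis by (simp add: P_comp_def)
qed

section \<open>The pair (n, m) on the five polygons of a band\<close>

context
  fixes j x y :: nat
  assumes x: "x = F (j + 1)" and y: "y = F j"
begin

lemma F_eqs: "F (j + 2) = x + y" "F (j + 3) = 2 * x + y" "F (j + 4) = 3 * x + 2 * y"
  by (simp_all add: x y numeral_eq_Suc)

lemma xy_ineqs: "0 < y" "y \<le> x" "x \<le> 2 * y"
proof -
  show "0 < y" "y \<le> x" unfolding x y by (simp_all add: F_mono)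
  show "x \<le> 2 * y"
  proof (cases j)
    case (Suc i)
    thus ?thesis using F_mono[of i "Suc i"] by (simp add: x y)
  qed (simp add: x y)
qed

lemma xy_strict: "0 < j \<Longrightarrow> y < x"
  using F_less_Suc[of "j - 1"] by (simp add: x y)

lemma xy_reals: "0 < real y" "real y \<le> real x" "real x \<le> 2 * real y"
  using xy_ineqs by auto

text \<open>Passing to the next band replaces \<open>(x, y)\<close> by \<open>(x + y, x)\<close>;
  passing to the previous one replaces it by \<open>(y, x - y)\<close>.\<close>

lemma xy_up: "x + y = F (Suc j + 1)" "x = F (Suc j)"
  by (simp_all add: x y)

lemma xy_down: "j = Suc i \<Longrightarrow> y = F (i + 1)" "j = Suc i \<Longrightarrow> x - y = F i"
  by (simp_all add: x y)

lemma alpha_len_xy: "alpha_len x = x" "alpha_len y = y" "alpha_len (x + y) = x + y" "alpha_len (2 * x + y) = 2 * x + y"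
    "alpha_len (3 * x + 2 * y) = 3 * x + 2 * y"
  unfolding F_eqs[symmetric] unfolding x y by (rule alpha_len_F)+

text \<open>The self-similarity behind the recursion: adding \<open>2 * x\<close> carries this
  window onto the gap between \<open>F (j + 3)\<close> and \<open>F (j + 4)\<close>, where
  \<open>iota\<close> undoes the shift.\<close>

lemma alpha_len_shift: "y < k \<Longrightarrow> k < x + 2 * y \<Longrightarrow> alpha_len (k + 2 * x) = alpha_len k"
  using alpha_len_gap[of j "k + 2 * x"] unfolding F_eqs x[symmetric] by simp

text \<open>The digit in the names from \<open>sigma0\<close> to \<open>delta3\<close> is the offset
  from \<open>j\<close> of the index at which the gap begins.\<close>

lemma sigma0:
  assumes "y < k" "k < x"
  shows "real k + real (alpha_len k) \<le> 2 * real y"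
proof -
  have "k + alpha_len k \<le> 2 * y" using sigma_gap[of j k] assms by (simp add: x y)
  hence "real (k + alpha_len k) \<le> real (2 * y)" by (simp only: of_nat_le_iff)
  thus ?thesis by simp
qed

lemma sigma1:
  assumes "x < k" "k < x + y"
  shows "real k + real (alpha_len k) \<le> 2 * real x"
proof -
  have "k + alpha_len k \<le> 2 * x" using sigma_gap[of "j + 1" k] assms by (simp add: x y)
  hence "real (k + alpha_len k) \<le> real (2 * x)" by (simp only: of_nat_le_iff)
  thus ?thesis by simp
qed

lemma sigma3:
  assumes "2 * x + y < k" "k < 3 * x + 2 * y"
  shows "real k + real (alpha_len k) \<le> 4 * real x + 2 * real y"
proof -
  have "k + alpha_len k \<le> 2 * (2 * x + y)"
    using sigma_gap[of "j + 3" k] F_eqs assms by (simp add: numeral_eq_Suc)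
  hence "real (k + alpha_len k) \<le> real (2 * (2 * x + y))" by (simp only: of_nat_le_iff)
  thus ?thesis by simp
qed

lemma delta2:
  assumes "x + y < k" "k < 2 * x + y"
  shows "real (alpha_len k) + 2 * real y \<le> real k"
proof -
  have "alpha_len k + 2 * y \<le> k"
    using delta_gap[of j k] F_eqs assms y by (simp add: numeral_eq_Suc)
  hence "real (alpha_len k + 2 * y) \<le> real k" by (simp only: of_nat_le_iff)
  thus ?thesis by simp
qed

lemma delta3:
  assumes "2 * x + y < k" "k < 3 * x + 2 * y"
  shows "real (alpha_len k) + 2 * real x \<le> real k"
proof -
  have "alpha_len k + 2 * x \<le> k"
    using delta_gap[of "j + 1" k] F_eqs assms x by (simp add: numeral_eq_Suc)
  hence "real (alpha_len k + 2 * x) \<le> real k" by (simp only: of_nat_le_iff)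
  thus ?thesis by simp
qed

lemma in_A_less:
  assumes "in_A s t k" "s < 6 * real x + 4 * real y"
  shows "k < 3 * x + 2 * y"
proof -
  have "real k < real (3 * x + 2 * y)" using assms by (simp add: in_A_def)
  thus ?thesis by (simp only: of_nat_less_iff)
qed

text \<open>By \<open>delta3\<close> a larger candidate inside the gap would need
  \<open>s - t\<close> to be at least \<open>2 * x\<close>, and \<open>in_A_less\<close> excludes
  those beyond the gap.\<close>

lemma max_u_near:
  assumes "4 * real x + 2 * real y \<le> s" "s < 6 * real x + 4 * real y" "t \<le> s" "s - t < 2 * real x"
  shows "in_A s t (2 * x + y)" "\<forall>k>2 * x + y. \<not> in_A s t k"
proof -
  show "in_A s t (2 * x + y)" using assms by (simp add: in_A_def alpha_len_xy)
  show "\<forall>k>2 * x + y. \<not> in_A s t k"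
  proof (intro allI impI notI)
    fix k assume k: "k > 2 * x + y" "in_A s t k"
    from in_A_less[OF k(2) assms(2)] k(1) have "real (alpha_len k) + 2 * real x \<le> real k" by (intro delta3)
    thus False using k(2) assms(4) by (simp add: in_A_def)
  qed
qed

text \<open>At \<open>3 * x\<close> the sum \<open>m + alpha_len m\<close> is \<open>4 * x\<close>,
  which reaches \<open>t\<close>. Before that, \<open>sigma0\<close> after the shift bounds it by
  \<open>2 * x + 2 * y\<close>, which is less than \<open>t\<close>.\<close>

lemma state_near_low:
  assumes "4 * real x + 2 * real y \<le> s" "s - t < 2 * real x" "t \<le> 4 * real x"
  shows "state s t (2 * x + y) (3 * x)"
proof -
  \<comment> \<open>The polygon is empty for \<open>y = x\<close>: the hypotheses give
    \<open>4 * x + 2 * y < 6 * x\<close>.\<close>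
  have "real y < real x" using assms by linarith
  hence yx: "y < x" by simp
  have alpha_len: "alpha_len (3 * x) = x" using alpha_len_shift[of x] yx xy_ineqs alpha_len_xy by simp
  have "\<not> in_C s t k" if k: "2 * x + y < k" "k < 3 * x" for k
  proof -
    define l where "l = k - 2 * x"
    have l: "k = l + 2 * x" using k(1) by (simp add: l_def)
    hence "y < l" "l < x" using k by auto
    hence "real k + real (alpha_len k) \<le> 2 * real x + 2 * real y"
      using sigma0[of l] alpha_len_shift[of l] l by simp
    thus ?thesis using assms by (simp add: in_C_def)
  qed
  thus ?thesis unfolding state_def using max_u_near[of s t] assms yx
    by (simp add: in_C_def alpha_len)
qed

text \<open>The sum \<open>m + alpha_len m\<close> is at most \<open>4 * x\<close> before
  \<open>3 * x + y\<close> and equals \<open>4 * x + 2 * y\<close> there.\<close>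

lemma state_near_mid:
  assumes "4 * real x + 2 * real y \<le> s" "s - t < 2 * real x" "4 * real x < t" "t \<le> 4 * real x + 2 * real y"
  shows "state s t (2 * x + y) (3 * x + y)"
proof -
  have alpha_len: "alpha_len (3 * x + y) = x + y" using alpha_len_shift[of "x + y"] xy_ineqs alpha_len_xy by simp
  have "\<not> in_C s t k" if k: "2 * x + y < k" "k < 3 * x + y" for k
  proof -
    define l where "l = k - 2 * x"
    have l: "k = l + 2 * x" using k(1) by (simp add: l_def)
    hence *: "y < l" "l < x + y" using k by auto
    have "real l + real (alpha_len l) \<le> 2 * real x"
    proof (cases "l \<le> x")
      case True
      thus ?thesis using alpha_len_le[of l] by linarith
    qed (use sigma1[of l] * in simp)
    hence "real k + real (alpha_len k) \<le> 4 * real x"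
      using alpha_len_shift[of l] l * xy_ineqs by simp
    thus ?thesis using assms by (simp add: in_C_def)
  qed
  thus ?thesis unfolding state_def using max_u_near[of s t] assms xy_ineqs
    by (simp add: in_C_def alpha_len)
qed

lemma state_near_high:
  assumes "4 * real x + 2 * real y < t" "s < 6 * real x + 4 * real y" "t \<le> s" "s - t < 2 * real x"
  shows "state s t (2 * x + y) (3 * x + 2 * y)"
proof -
  have "\<not> in_C s t k" if "2 * x + y < k" "k < 3 * x + 2 * y" for k
    using sigma3[OF that] assms by (simp add: in_C_def)
  thus ?thesis unfolding state_def using max_u_near[of s t] assms xy_ineqs
    by (simp add: in_C_def alpha_len_xy)
qed

text \<open>The deficit \<open>n - alpha_len n\<close> is \<open>2 * x\<close> at
  \<open>3 * x + y\<close>. For larger \<open>n\<close> in the gap, \<open>delta2\<close> after the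
  shift makes it at least \<open>2 * x + 2 * y\<close>, which exceeds \<open>s - t\<close>.\<close>

lemma state_far_high:
  assumes "4 * real x + 2 * real y < t" "s < 6 * real x + 4 * real y" "2 * real x \<le> s - t"
  shows "state s t (3 * x + y) (3 * x + 2 * y)"
proof -
  have alpha_len: "alpha_len (3 * x + y) = x + y" using alpha_len_shift[of "x + y"] xy_ineqs alpha_len_xy by simp
  have "\<not> in_C s t k" if "3 * x + y < k" "k < 3 * x + 2 * y" for k
    using sigma3[of k] that assms by (simp add: in_C_def)
  moreover have "\<not> in_A s t k" if k: "3 * x + y < k" for k
  proof
    assume A: "in_A s t k"
    have k': "k < 3 * x + 2 * y" using in_A_less A assms by blast
    define l where "l = k - 2 * x"
    have l: "k = l + 2 * x" using k(1) by (simp add: l_def)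
    hence "x + y < l" "l < 2 * x + y" "l < x + 2 * y" using k k' xy_ineqs by auto
    hence "real (alpha_len k) + 2 * real x + 2 * real y \<le> real k"
      using delta2[of l] alpha_len_shift[of l] l by simp
    thus False using A assms by (simp add: in_A_def)
  qed
  ultimately show ?thesis unfolding state_def using assms xy_ineqs
    by (simp add: in_C_def in_A_def alpha_len_xy alpha_len)
qed

text \<open>Shifting the length by \<open>2 * x\<close> and the point by
  \<open>(4 * x, 2 * x)\<close> preserves \<open>in_A\<close> and \<open>in_C\<close> inside the
  window of \<open>alpha_len_shift\<close>. The extreme values \<open>n = y\<close> and
  \<open>m = x + 2 * y\<close> lie outside it and are checked directly: they shift to
  \<open>F (j + 3)\<close> and \<open>F (j + 4)\<close>, which alpha fixes.\<close>

lemma state_far_low: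
  assumes "4 * real x + 2 * real y \<le> s" "s < 6 * real x + 4 * real y"
    "2 * real x \<le> s - t" "t \<le> 4 * real x + 2 * real y"
    and st: "state (s - 4 * real x) (t - 2 * real x) n m"
  shows "state s t (n + 2 * x) (m + 2 * x)"
proof -
  define s' t' where "s' = s - 4 * real x" and "t' = t - 2 * real x"
  note st = st[folded s'_def t'_def, unfolded state_def]
  have in_A_shift: "in_A s t (k + 2 * x) \<longleftrightarrow> in_A s' t' k" if "y < k" "k < x + 2 * y" for k
    using that by (auto simp: in_A_def s'_def t'_def alpha_len_shift)
  have in_C_shift: "in_C s t (k + 2 * x) \<longleftrightarrow> in_C s' t' k" if "y < k" "k < x + 2 * y" for k
    using that by (auto simp: in_C_def s'_def t'_def alpha_len_shift)
  have "in_A s' t' y" using assms by (simp add: in_A_def s'_def t'_def alpha_len_xy)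
  hence yn: "y \<le> n" using st not_less by blast
  have n2: "n < x + 2 * y"
  proof -
    have "in_A s' t' n" using st by blast
    hence "real n < real (x + 2 * y)" using assms by (simp add: in_A_def s'_def)
    thus ?thesis by (simp only: of_nat_less_iff)
  qed
  have u1: "in_A s t (n + 2 * x)"
  proof (cases "n = y")
    case True
    have "alpha_len (y + 2 * x) = y + 2 * x" using alpha_len_xy by (simp add: add.commute)
    thus ?thesis using True assms by (simp add: in_A_def)
  qed (use in_A_shift yn n2 st in auto)
  have u2: "\<not> in_A s t k" if "k > n + 2 * x" for k
  proof
    assume A: "in_A s t k"
    have "k < 3 * x + 2 * y" using in_A_less A assms by blast
    define l where "l = k - 2 * x"
    have l: "k = l + 2 * x" using that by (simp add: l_def)
    hence "in_A s' t' l" using A in_A_shift[of l] \<open>k < _\<close> yn that by auto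
    thus False using st l that by auto
  qed
  \<comment> \<open>Since \<open>t'\<close> is at most \<open>2 * x + 2 * y\<close>, this makes
    \<open>x + 2 * y\<close> satisfy \<open>in_C\<close> and so caps \<open>m\<close>.\<close>
  have "alpha_len (x + 2 * y) \<ge> x"
  proof (cases j)
    case 0
    hence "x = y" by (simp add: x y)
    thus ?thesis using alpha_len_xy(4) by simp
  next
    case (Suc i)
    have "F (i + 3) = x + y" "F (i + 4) = 2 * x + y" "F (i + 1) = y"
      using Suc by (auto simp: x y numeral_eq_Suc)
    hence "alpha_len (x + 2 * y) = alpha_len x" using alpha_len_gap[of i "x + 2 * y"] xy_ineqs xy_strict Suc by simp
    thus ?thesis by (simp add: alpha_len_xy)
  qed
  hence "in_C s' t' (x + 2 * y)" using assms by (simp add: in_C_def s'_def t'_def)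
  hence m2: "m \<le> x + 2 * y" using st n2 not_less by blast
  have w1: "in_C s t (m + 2 * x)"
  proof (cases "m = x + 2 * y")
    case True
    hence "m + 2 * x = 3 * x + 2 * y" by simp
    thus ?thesis using assms alpha_len_xy by (simp add: in_C_def)
  next
    case False
    hence "y < m" "m < x + 2 * y" using yn m2 st by auto
    thus ?thesis using in_C_shift st by blast
  qed
  have w2: "\<not> in_C s t k" if "n + 2 * x < k" "k < m + 2 * x" for k
  proof
    assume A: "in_C s t k"
    define l where "l = k - 2 * x"
    have l: "k = l + 2 * x" using that(1) by (simp add: l_def)
    hence "y < l" "l < x + 2 * y" using that yn m2 by auto
    hence "in_C s' t' l" using A in_C_shift[of l] l by auto
    thus False using st l that by auto
  qed
  show ?thesis unfolding state_def using u1 u2 w1 w2 st by auto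
qed

lemma P_comp_far_low_open:
  assumes "4 * real x + 2 * real y \<le> s" "s < 6 * real x + 4 * real y"
    "2 * real x \<le> s - t" "t \<le> 4 * real x + 2 * real y"
  shows "P_comp k s t = P_comp k (s - 4 * real x) (t - 2 * real x) + 2 * real x"
proof -
  obtain n m where nm: "state (s - 4 * real x) (t - 2 * real x) n m"
    using state_exists[of "s - 4 * real x" "t - 2 * real x"] assms by auto
  have "P_comp k s t = sorted3 k (s - 4 * real x - real n + 2 * real x)
      (t - 2 * real x + real n - real m + 2 * real x) (real m + 2 * real x)"
    using P_comp_state[OF state_far_low[OF assms nm], of k] by (simp add: algebra_simps)
  thus ?thesis unfolding sorted3_add using P_comp_state[OF nm] by simp
qed

end

section \<open>Points below the first band and points on the diagonal\<close>

lemma alpha_len_small: "k \<le> 3 \<Longrightarrow> alpha_len k = k"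
proof -
  assume "k \<le> 3"
  then consider "k = 0" | "k = F 1" | "k = F 2" | "k = F 3" by (force simp: numeral_eq_Suc)
  thus ?thesis by cases (auto simp del: F_simps)
qed

lemma state_low:
  assumes "l \<le> 2" "2 * real l \<le> s" "s < 2 * real l + 2" "t \<le> s"
  shows "state s t l (Suc l)"
proof -
  have "\<not> in_A s t k" if "k > l" for k
  proof -
    from that have "real k \<ge> real l + 1" by linarith
    thus ?thesis using assms by (simp add: in_A_def)
  qed
  thus ?thesis using assms by (simp add: state_def in_A_def in_C_def alpha_len_small)
qed

lemma P_comp_diag_open:
  assumes "2 * real (F i) \<le> t" "t < 2 * real (F (Suc i))"
  shows "P_comp k t t = sorted3 k (t - real (F i)) (t - (real (F (Suc i)) - real (F i))) (real (F (Suc i)))"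
proof (cases "i < 3")
  case True
  hence "i = 0 \<or> i = 1 \<or> i = 2" by linarith
  \<comment> \<open>For \<open>i = 0\<close> the interval is empty, as
    \<open>F 0 = F 1\<close>.\<close>
  hence "i > 0" "F (Suc i) = Suc (F i)" "F i \<le> 2" using assms by (auto simp: numeral_eq_Suc)
  with P_comp_state[OF state_low[of "F i" t t]] assms show ?thesis by (simp add: algebra_simps)
next
  case False
  then obtain j where i: "i = j + 3" by (metis add.commute le_Suc_ex not_less)
  define x y where xy: "x = F (j + 1)" "y = F j"
  have F: "F i = 2 * x + y" "F (Suc i) = 3 * x + 2 * y"
    using F_eqs[OF xy] by (simp_all add: i numeral_eq_Suc)
  show ?thesis
  proof (cases "t = 2 * real (F i)")
    case True
    have "state t t (2 * x + y) (3 * x + y)"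
      using True assms xy_ineqs[OF xy] by (intro state_near_mid[OF xy]) (auto simp: F)
    from P_comp_state[OF this] show ?thesis unfolding F True by simp (intro sorted3_perms; simp)
  next
    case False
    have "state t t (2 * x + y) (3 * x + 2 * y)"
      using False assms xy_ineqs[OF xy] by (intro state_near_high[OF xy]) (auto simp: F)
    from P_comp_state[OF this] show ?thesis unfolding F by (simp add: algebra_simps)
  qed
qed

text \<open>The diagonal matters because the recursion sends the edge \<open>s - t = 2 * x\<close>
  of a band to it. The right endpoint is evaluated in the next interval.\<close>

lemma P_comp_diag:
  assumes "2 * real (F i) \<le> t" "t \<le> 2 * real (F (Suc i))"
  shows "P_comp k t t = sorted3 k (t - real (F i)) (t - (real (F (Suc i)) - real (F i))) (real (F (Suc i)))"
proof (cases "t < 2 * real (F (Suc i))")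
  case False
  hence t: "t = 2 * real (F (Suc i))" using assms by simp
  have "P_comp k t t = sorted3 k (t - real (F (Suc i))) (t - real (F i)) (real (F (Suc (Suc i))))"
    using P_comp_diag_open[of "Suc i" t k] t by simp
  also have "sorted3 k (t - real (F (Suc i))) (t - real (F i)) (real (F (Suc (Suc i)))) =
      sorted3 k (real (F (Suc i))) (t - real (F i)) (t - (real (F (Suc i)) - real (F i)))"
    by (simp add: t)
  also have "\<dots> = sorted3 k (t - real (F i)) (t - (real (F (Suc i)) - real (F i))) (real (F (Suc i)))"
    by (metis sorted3_perms(1,3))
  finally show ?thesis .
qed (use assms P_comp_diag_open in auto)

section \<open>Formulas on the closed polygons\<close>

context
  fixes j x y :: nat
  assumes x: "x = F (j + 1)" and y: "y = F j"
begin

lemma P_comp_near_low: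
  assumes "4 * real x + 2 * real y \<le> s" "s - t \<le> 2 * real x" "t \<le> 4 * real x"
  shows "P_comp k s t = sorted3 k (s - 2 * real x - real y) (t - real x + real y) (3 * real x)"
proof (cases "s - t < 2 * real x")
  case True
  from P_comp_state[OF state_near_low[OF x y assms(1) True assms(3)]] show ?thesis by (simp add: algebra_simps)
next
  case False
  hence s: "s = t + 2 * real x" using assms by simp
  have "P_comp k s t = P_comp k (t - 2 * real x) (t - 2 * real x) + 2 * real x"
    using P_comp_far_low_open[OF x y, of s t] assms s xy_reals[OF x y] by simp
  also have "P_comp k (t - 2 * real x) (t - 2 * real x) = sorted3 k (t - 2 * real x - real y) (t - 2 * real x - (real x - real y)) (real x)"
    \<comment> \<open>On this edge \<open>t - 2 * x\<close> lies between \<open>2 * F j\<close> and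
      \<open>2 * F (j + 1)\<close>.\<close>
    using P_comp_diag[of j "t - 2 * real x" k] assms s xy_reals[OF x y] by (simp add: x y)
  finally show ?thesis unfolding sorted3_add[symmetric] by (simp add: s algebra_simps)
qed

lemma P_comp_near_mid:
  assumes "4 * real x + 2 * real y \<le> s" "s - t \<le> 2 * real x" "4 * real x \<le> t" "t \<le> 4 * real x + 2 * real y"
  shows "P_comp k s t = sorted3 k (s - 2 * real x - real y) (t - real x) (3 * real x + real y)"
proof (cases "s - t < 2 * real x")
  case True
  show ?thesis
  proof (cases "t = 4 * real x")
    case True
    with P_comp_near_low[of s t k] assms show ?thesis by simp (intro sorted3_perms; simp)
  next
    case False
    hence "4 * real x < t" using assms by simp
    from P_comp_state[OF state_near_mid[OF x y assms(1) True this assms(4)]] show ?thesis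
      by (simp add: algebra_simps)
  qed
next
  case False
  hence s: "s = t + 2 * real x" using assms by simp
  have "P_comp k s t = P_comp k (t - 2 * real x) (t - 2 * real x) + 2 * real x"
    using P_comp_far_low_open[OF x y, of s t] assms s xy_reals[OF x y] by simp
  also have "P_comp k (t - 2 * real x) (t - 2 * real x) = sorted3 k (t - 2 * real x - real x) (t - 2 * real x - real y) (real x + real y)"
    \<comment> \<open>Now \<open>t - 2 * x\<close> lies between \<open>2 * x\<close> and
      \<open>2 * x + 2 * y\<close>, one interval further up.\<close>
    using P_comp_diag[of "j + 1" "t - 2 * real x" k] assms s xy_reals[OF x y] by (simp add: x y)
  finally show ?thesis using xy_reals[OF x y] by (simp add: sorted3_add[symmetric] s) (intro sorted3_perms; simp)
qed

end

context
  fixes j x y :: nat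
  assumes x: "x = F (j + 1)" and y: "y = F j"
begin

text \<open>The three excluded edges belong to neighbours: the middle polygon, the far polygon, and
  the next band. The context is reopened so that the earlier formulas can be applied to that next
  band.\<close>

lemma P_comp_near_high:
  assumes "4 * real x + 2 * real y \<le> t" "s \<le> 6 * real x + 4 * real y" "t \<le> s" "s - t \<le> 2 * real x"
  shows "P_comp k s t = sorted3 k (s - 2 * real x - real y) (t - real x - real y) (3 * real x + 2 * real y)"
proof (cases "t = 4 * real x + 2 * real y")
  case True
  with P_comp_near_mid[OF x y, of s t k] assms show ?thesis by simp (intro sorted3_perms; simp)
next
  case t: False
  show ?thesis
  proof (cases "s < 6 * real x + 4 * real y")
    case s: True
    show ?thesis
    proof (cases "s - t < 2 * real x")
      case True
      with s t assms have "state s t (2 * x + y) (3 * x + 2 * y)" by (intro state_near_high[OF x y]) auto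
      from P_comp_state[OF this] show ?thesis by (simp add: algebra_simps)
    next
      case False
      with s t assms have "state s t (3 * x + y) (3 * x + 2 * y)" by (intro state_far_high[OF x y]) auto
      moreover have "s = t + 2 * real x" using False assms by simp
      ultimately show ?thesis using P_comp_state by simp (intro sorted3_perms; simp)
    qed
  next
    case False
    hence s: "s = 6 * real x + 4 * real y" using assms by simp
    from P_comp_near_mid[OF xy_up[OF x y], of s t k] assms s xy_reals[OF x y] show ?thesis by simp (intro sorted3_perms; simp)
  qed
qed

end

context
  fixes j x y :: nat
  assumes x: "x = F (j + 1)" and y: "y = F j"
begin

lemma P_comp_far_high:
  assumes "4 * real x + 2 * real y \<le> t" "s \<le> 6 * real x + 4 * real y" "2 * real x \<le> s - t"
  shows "P_comp k s t = sorted3 k (s - 3 * real x - real y) (t - real y) (3 * real x + 2 * real y)"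
proof (cases "s < 6 * real x + 4 * real y")
  case False
  hence s: "s = 6 * real x + 4 * real y" using assms by simp
  \<comment> \<open>The top edge of the band is the bottom edge of the next one.\<close>
  from P_comp_near_low[OF xy_up[OF x y], of s t k] assms s xy_reals[OF x y] show ?thesis by simp (intro sorted3_perms; simp)
next
  case s: True
  show ?thesis
  proof (cases "t = 4 * real x + 2 * real y")
    case False
    with s assms have "state s t (3 * x + y) (3 * x + 2 * y)" by (intro state_far_high[OF x y]) auto
    from P_comp_state[OF this] show ?thesis by (simp add: algebra_simps)
  next
    case t: True
    \<comment> \<open>This edge is shared with the recursive polygon; the reduced point is evaluated
      in the previous band, or below all bands when \<open>j = 0\<close>.\<close>
    have "P_comp k s t = P_comp k (s - 4 * real x) (t - 2 * real x) + 2 * real x"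
      using P_comp_far_low_open[OF x y, of s t] assms s xy_reals[OF x y] t by simp
    also have "P_comp k (s - 4 * real x) (t - 2 * real x) =
        sorted3 k (s - 5 * real x - real y) (real x + 2 * real y) (2 * real x + real y)"
    proof (cases j)
      case 0
      hence "x = 1" "y = 1" by (simp_all add: x y)
      with P_comp_state[OF state_low[of 2 "s - 4" "t - 2"], of k] s t assms show ?thesis by simp
    next
      case (Suc i)
      have "real (x - y) = real x - real y" using xy_reals[OF x y] by simp
      with P_comp_near_high[OF xy_down[OF x y Suc], of "t - 2 * real x" "s - 4 * real x" k] s t assms xy_reals[OF x y] show ?thesis
        by (simp add: algebra_simps)
    qed
    finally show ?thesis using t by (simp add: sorted3_add[symmetric]) (intro sorted3_perms; simp)
  qed
qed

lemma P_comp_far_low: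
  assumes "4 * real x + 2 * real y \<le> s" "s \<le> 6 * real x + 4 * real y"
    "2 * real x \<le> s - t" "t \<le> 4 * real x + 2 * real y"
  shows "P_comp k s t = P_comp k (s - 4 * real x) (t - 2 * real x) + 2 * real x"
proof (cases "s < 6 * real x + 4 * real y")
  case True
  with P_comp_far_low_open[OF x y] assms show ?thesis by simp
next
  case False
  hence s: "s = 6 * real x + 4 * real y" using assms by simp
  \<comment> \<open>On the top edge the next band subtracts \<open>4 * (x + y)\<close> from
    \<open>s\<close> at once, while this band subtracts \<open>4 * x\<close> and a second reduction
    then subtracts \<open>4 * y\<close>.\<close>
  have "P_comp k s t = P_comp k (s - 4 * real (x + y)) (t - 2 * real (x + y)) + 2 * real (x + y)"
    using s xy_reals[OF x y] assms by (intro P_comp_far_low_open[OF xy_up[OF x y]]) auto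
  moreover have "P_comp k (s - 4 * real x) (t - 2 * real x) =
      P_comp k (s - 4 * real x - 4 * real y) (t - 2 * real x - 2 * real y) + 2 * real y"
  proof (cases j)
    case 0
    \<comment> \<open>With no previous band, the same band serves for the second reduction.\<close>
    hence "x = 1" "y = 1" by (simp_all add: x y)
    with P_comp_far_low_open[OF x y, of "s - 4" "t - 2" k] s assms show ?thesis by simp
  next
    case (Suc i)
    have "real (x - y) = real x - real y" "real y < real x" using xy_reals[OF x y] xy_strict[OF x y] Suc by simp_all
    with s xy_reals[OF x y] assms show ?thesis by (intro P_comp_far_low_open[OF xy_down[OF x y Suc]]) simp_all
  qed
  ultimately show ?thesis by (simp add: algebra_simps)
qed

end

lemma P_comp_low:
  assumes "l \<le> 2" "2 * real l \<le> s" "s \<le> 2 * real l + 2" "t \<le> s"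
  shows "P_comp k s t = sorted3 k (s - real l) (t - 1) (real l + 1)"
proof (cases "s < 2 * real l + 2")
  case True
  with P_comp_state[OF state_low[of l s t]] assms show ?thesis by (simp add: add.commute)
next
  case False
  hence s: "s = 2 * real l + 2" using assms by simp
  show ?thesis
  proof (cases "l < 2")
    case True
    with P_comp_state[OF state_low[of "Suc l" s t]] assms s show ?thesis by simp (intro sorted3_perms; simp)
  next
    case False
    \<comment> \<open>Then \<open>s = 6\<close>, the bottom edge of the first band, where
      \<open>x = y = 1\<close>.\<close>
    hence l: "l = 2" using assms by simp
    have PP2: "P_comp k 2 (t - 2) = sorted3 k 1 (t - 3) 2" if "t \<le> 4"
      using P_comp_state[OF state_low[of 1 2 "t - 2"], of k] that by simp
    show ?thesis
    proof (cases "t \<le> 4")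
      case True
      with P_comp_far_low[of 1 0 1 6 t k] PP2 s l show ?thesis by (simp add: sorted3_add[symmetric]) (intro sorted3_perms; simp)
    next
      case False
      with P_comp_near_mid[of 1 0 1 6 t k] assms s l show ?thesis by simp (intro sorted3_perms; simp)
    qed
  qed
qed

section \<open>Lipschitz continuity\<close>

definition supnorm :: "real \<times> real \<Rightarrow> real" where
  "supnorm p = max \<bar>fst p\<bar> \<bar>snd p\<bar>"

text \<open>The segment from \<open>p\<close> to \<open>q\<close> stays in \<open>D\<close>. Its
  parameter interval is covered by finitely many closed sets on each of which the bound holds, and
  Lipschitz bounds on such a cover combine with the same constant.\<close>

lemma lipschitz_glue:
  fixes f :: "real \<times> real \<Rightarrow> real"
  assumes conv: "convex D" and fin: "finite \<X>" and cl: "\<And>X. X \<in> \<X> \<Longrightarrow> closed X"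
    and cov: "D \<subseteq> \<Union>\<X>"
    and lip: "\<And>X p q. X \<in> \<X> \<Longrightarrow> p \<in> X \<inter> D \<Longrightarrow> q \<in> X \<inter> D \<Longrightarrow> \<bar>f p - f q\<bar> \<le> supnorm (p - q)"
    and pq: "p \<in> D" "q \<in> D"
  shows "\<bar>f p - f q\<bar> \<le> supnorm (p - q)"
proof -
  define g where "g r = p + r *\<^sub>R (q - p)" for r
  have gD: "g r \<in> D" if "r \<in> {0..1}" for r
  proof -
    have "(1 - r) *\<^sub>R p + r *\<^sub>R q \<in> D" using that pq by (intro convexD[OF conv]) auto
    thus ?thesis by (simp add: g_def algebra_simps)
  qed
  have "(supnorm (p - q))-lipschitz_on {0..1} (f \<circ> g)"
  proof (rule lipschitz_on_closed_Union[where I = \<X> and U = "\<lambda>X. {0..1} \<inter> g -` X"])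
    fix X assume X: "X \<in> \<X>"
    have "closed (g -` X)" unfolding g_def
      by (intro continuous_closed_vimage cl X) (auto intro!: continuous_intros)
    thus "closed ({0..1} \<inter> g -` X)" by auto
    show "(supnorm (p - q))-lipschitz_on ({0..1} \<inter> g -` X) (f \<circ> g)"
    proof (rule lipschitz_onI)
      fix r r' assume r: "r \<in> {0..1} \<inter> g -` X" "r' \<in> {0..1} \<inter> g -` X"
      have "dist ((f \<circ> g) r) ((f \<circ> g) r') \<le> supnorm (g r - g r')"
        using r gD by (auto simp: dist_real_def intro: lip[OF X])
      also have "g r - g r' = (r' - r) *\<^sub>R (p - q)" by (simp add: g_def algebra_simps)
      also have "supnorm \<dots> = supnorm (p - q) * dist r r'"
        by (simp add: supnorm_def dist_real_def abs_mult max_mult_distrib_left abs_minus_commute[of r' r] mult.commute flip: right_diff_distrib)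
      finally show "dist ((f \<circ> g) r) ((f \<circ> g) r') \<le> supnorm (p - q) * dist r r'" .
    qed (simp add: supnorm_def)
  next
    show "{0..1} \<subseteq> (\<Union>X\<in>\<X>. {0..1} \<inter> g -` X)" using cov gD by blast
  qed (use fin in \<open>auto simp: supnorm_def\<close>)
  from lipschitz_onD[OF this, of 0 1] show ?thesis
    by (simp add: g_def dist_real_def)
qed

definition wedge :: "real \<Rightarrow> (real \<times> real) set" where
  "wedge M = {p. 0 \<le> fst p \<and> fst p \<le> M \<and> snd p \<le> fst p}"

lemma convex_wedge: "convex (wedge M)"
proof (rule convexI)
  fix p q :: "real \<times> real" and u v :: real
  assume *: "p \<in> wedge M" "q \<in> wedge M" "0 \<le> u" "0 \<le> v" "u + v = 1"
  have "u * fst p + v * fst q \<le> M" using * by (intro convex_bound_le) (auto simp: wedge_def)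
  thus "u *\<^sub>R p + v *\<^sub>R q \<in> wedge M"
    using * by (auto simp: wedge_def intro!: add_mono mult_left_mono)
qed

lemma closed_wedge: "closed (wedge M)"
  unfolding wedge_def by (intro closed_Collect_conj closed_Collect_le continuous_intros)

lemma lipschitz_affine:
  assumes "\<And>p. p \<in> X \<Longrightarrow> f p = sorted3 k (fst p - a) (snd p - b) c" "p \<in> X" "q \<in> X"
  shows "\<bar>f p - f q\<bar> \<le> supnorm (p - q)"
  unfolding assms(1)[OF assms(2)] assms(1)[OF assms(3)]
  by (rule sorted3_lipschitz) (simp_all add: supnorm_def)

text \<open>Induction over the bands: four polygons have explicit formulas, and the fifth is
  translated into the smaller wedge, which changes no differences.\<close>

lemma P_comp_lipschitz_wedge:
  assumes "p \<in> wedge (2 * real (F (j + 3)))" "q \<in> wedge (2 * real (F (j + 3)))"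
  shows "\<bar>P_comp k (fst p) (snd p) - P_comp k (fst q) (snd q)\<bar> \<le> supnorm (p - q)"
  using assms
proof (induction j arbitrary: p q)
  case 0
  define U where "U l = {p :: real \<times> real. 2 * real l \<le> fst p \<and> fst p \<le> 2 * real l + 2}" for l
  have F3: "real (F 3) = 3" by (simp add: numeral_eq_Suc)
  show ?case
  proof (rule lipschitz_glue[where f = "\<lambda>p. P_comp k (fst p) (snd p)" and \<X> = "U ` {0,1,2}", OF convex_wedge _ _ _ _ 0])
    show "closed X" if "X \<in> U ` {0, 1, 2}" for X
      using that by (auto simp: U_def intro!: closed_Collect_conj closed_Collect_le continuous_intros)
    show "wedge (2 * real (F (0 + 3))) \<subseteq> \<Union> (U ` {0, 1, 2})"
      by (auto simp: U_def wedge_def F3)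
    fix X p q assume X: "X \<in> U ` {0, 1, 2}" and *: "p \<in> X \<inter> wedge (2 * real (F (0 + 3)))" "q \<in> X \<inter> wedge (2 * real (F (0 + 3)))"
    from X obtain l where l: "l \<in> {0, 1, 2}" "X = U l" by blast
    show "\<bar>P_comp k (fst p) (snd p) - P_comp k (fst q) (snd q)\<bar> \<le> supnorm (p - q)"
    proof (rule lipschitz_affine[OF _ *])
      fix r assume "r \<in> X \<inter> wedge (2 * real (F (0 + 3)))"
      thus "P_comp k (fst r) (snd r) = sorted3 k (fst r - real l) (snd r - 1) (real l + 1)"
        using l(1) unfolding l(2) by (intro P_comp_low) (auto simp: U_def wedge_def)
    qed
  qed simp
next
  case (Suc j)
  define x y where xy: "x = F (j + 1)" "y = F j"
  note F = F_eqs[OF xy] and xyr = xy_reals[OF xy]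
  have F4: "real (F (Suc j + 3)) = 3 * real x + 2 * real y" using F(3) by (simp add: numeral_eq_Suc del: F_simps)
  have F3: "real (F (j + 3)) = 2 * real x + real y" using F(2) by simp
  define f where "f p = P_comp k (fst p) (snd p)" for p
  define D where "D = wedge (6 * real x + 4 * real y)"
  define A where "A = {p :: real \<times> real. 4 * real x + 2 * real y \<le> fst p \<and> fst p - snd p \<le> 2 * real x \<and> snd p \<le> 4 * real x}"
  define B where "B = {p :: real \<times> real. 4 * real x + 2 * real y \<le> fst p \<and> fst p - snd p \<le> 2 * real x \<and> 4 * real x \<le> snd p \<and> snd p \<le> 4 * real x + 2 * real y}"
  define C where "C = {p :: real \<times> real. fst p - snd p \<le> 2 * real x \<and> 4 * real x + 2 * real y \<le> snd p}"
  define E where "E = {p :: real \<times> real. 2 * real x \<le> fst p - snd p \<and> 4 * real x + 2 * real y \<le> snd p}"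
  define R where "R = {p :: real \<times> real. 4 * real x + 2 * real y \<le> fst p \<and> 2 * real x \<le> fst p - snd p \<and> snd p \<le> 4 * real x + 2 * real y}"
  note defs = A_def B_def C_def E_def R_def
  have D: "D = wedge (2 * real (F (Suc j + 3)))" unfolding F4 by (simp add: D_def)
  have D0: "wedge (2 * real (F (j + 3))) = wedge (4 * real x + 2 * real y)" by (simp add: F3)
  note IH = Suc.IH[unfolded D0]
  have "\<bar>f p - f q\<bar> \<le> supnorm (p - q)"
  proof (rule lipschitz_glue[where f = f and \<X> = "{wedge (4 * real x + 2 * real y), A, B, C, E, R}" and D = D])
    show "convex D" by (simp add: D_def convex_wedge)
    show "closed X" if "X \<in> {wedge (4 * real x + 2 * real y), A, B, C, E, R}" for X
      using that closed_wedge[of "4 * real x + 2 * real y"]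
      by (auto simp: defs intro!: closed_Collect_conj closed_Collect_le continuous_intros)
    show "D \<subseteq> \<Union> {wedge (4 * real x + 2 * real y), A, B, C, E, R}"
      by (auto simp: defs D_def wedge_def)
    show "p \<in> D" "q \<in> D" using Suc.prems by (auto simp: D)
    fix X p q assume X: "X \<in> {wedge (4 * real x + 2 * real y), A, B, C, E, R}" and p: "p \<in> X \<inter> D" and q: "q \<in> X \<inter> D"
    from X consider "X = wedge (4 * real x + 2 * real y)" | "X = A" | "X = B" | "X = C" | "X = E" | "X = R" by blast
    thus "\<bar>f p - f q\<bar> \<le> supnorm (p - q)"
    proof cases
      case 1
      with p q IH show ?thesis by (simp add: f_def)
    next
      case 2
      have "f r = sorted3 k (fst r - (2 * real x + real y)) (snd r - (real x - real y)) (3 * real x)" if "r \<in> X \<inter> D" for r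
        using that 2 P_comp_near_low[OF xy, of "fst r" "snd r" k] by (simp add: f_def A_def algebra_simps)
      from lipschitz_affine[OF this p q] show ?thesis .
    next
      case 3
      have "f r = sorted3 k (fst r - (2 * real x + real y)) (snd r - real x) (3 * real x + real y)" if "r \<in> X \<inter> D" for r
        using that 3 P_comp_near_mid[OF xy, of "fst r" "snd r" k] by (simp add: f_def B_def algebra_simps)
      from lipschitz_affine[OF this p q] show ?thesis .
    next
      case 4
      have "f r = sorted3 k (fst r - (2 * real x + real y)) (snd r - (real x + real y)) (3 * real x + 2 * real y)" if "r \<in> X \<inter> D" for r
        using that 4 P_comp_near_high[OF xy, of "snd r" "fst r" k] by (simp add: f_def C_def D_def wedge_def algebra_simps)
      from lipschitz_affine[OF this p q] show ?thesis .
    next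
      case 5
      have "f r = sorted3 k (fst r - (3 * real x + real y)) (snd r - real y) (3 * real x + 2 * real y)" if "r \<in> X \<inter> D" for r
        using that 5 P_comp_far_high[OF xy, of "snd r" "fst r" k] by (simp add: f_def E_def D_def wedge_def algebra_simps)
      from lipschitz_affine[OF this p q] show ?thesis .
    next
      case 6
      \<comment> \<open>The image lies in the smaller wedge because \<open>s - 4 * x\<close> is at
        most \<open>2 * x + 4 * y\<close>, hence at most \<open>4 * x + 2 * y\<close>.\<close>
      define T where "T p = p - (4 * real x, 2 * real x)" for p
      have f: "f r = f (T r) + 2 * real x" and T: "T r \<in> wedge (4 * real x + 2 * real y)" if "r \<in> X \<inter> D" for r
        using that 6 P_comp_far_low[OF xy, of "fst r" "snd r" k] xyr by (auto simp: f_def R_def D_def wedge_def T_def)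
      have "\<bar>f p - f q\<bar> = \<bar>f (T p) - f (T q)\<bar>" using f p q by simp
      also have "\<dots> \<le> supnorm (T p - T q)" unfolding f_def by (intro IH T p q)
      also have "T p - T q = p - q" by (simp add: T_def)
      finally show ?thesis .
    qed
  qed simp
  thus ?case by (simp add: f_def)
qed

lemma P_comp_lipschitz:
  assumes "0 \<le> s" "t \<le> s" "0 \<le> s'" "t' \<le> s'" "\<bar>s - s'\<bar> \<le> e" "\<bar>t - t'\<bar> \<le> e"
  shows "\<bar>P_comp k s t - P_comp k s' t'\<bar> \<le> e"
proof -
  define j where "j = nat \<lceil>max s s'\<rceil>"
  have "real j \<le> real (F (j + 3))" using F_ge[of "j + 3"] by linarith
  moreover have "max s s' \<le> real j" unfolding j_def by linarith
  ultimately have "(s, t) \<in> wedge (2 * real (F (j + 3)))" "(s', t') \<in> wedge (2 * real (F (j + 3)))"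
    using assms by (auto simp: wedge_def)
  from P_comp_lipschitz_wedge[OF this, of k] show ?thesis using assms by (simp add: supnorm_def)
qed

section \<open>Scaling by the golden ratio\<close>

text \<open>The witness is the point of the interval nearest to \<open>v\<close>; it serves to move
  a scaled coordinate into the polygon of the next band.\<close>

lemma clamp:
  fixes v :: real
  assumes "lo \<le> v + e" "v \<le> hi + e" "lo \<le> hi" "0 \<le> e"
  shows "\<exists>v'. lo \<le> v' \<and> v' \<le> hi \<and> \<bar>v - v'\<bar> \<le> e"
  using assms by (intro exI[of _ "max lo (min hi v)"]) auto

text \<open>As alpha fixes \<open>lo\<close> and \<open>hi\<close>, these are candidates for u and
  w, so \<open>n\<close> and \<open>m\<close> lie between them. Both are then within
  \<open>hi - lo\<close> of \<open>s / 2\<close>.\<close>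

lemma P_comp_near_center:
  assumes "2 * real lo \<le> s" "s < 2 * real hi" "t \<le> s" "alpha_len lo = lo" "alpha_len hi = hi"
  shows "\<bar>P_comp k s t - sorted3 k (s / 2) t (s / 2)\<bar> \<le> real hi - real lo"
proof -
  have "0 \<le> s" using assms by simp
  from state_exists[OF this assms(3)] obtain n m where nm: "state s t n m" .
  have "in_A s t lo" "in_C s t hi" using assms by (simp_all add: in_A_def in_C_def)
  moreover have "in_A s t n" "in_C s t m" using nm by (simp_all add: state_def)
  hence *: "2 * real n \<le> s" "s \<le> 2 * real m" by (simp_all add: in_A_def in_C_def)
  hence "n < hi" using assms by linarith
  ultimately have "lo \<le> n" "m \<le> hi" using nm unfolding state_def by (meson not_less)+
  thus ?thesis unfolding P_comp_state[OF nm] using * by (intro sorted3_lipschitz) auto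
qed

context
  fixes g :: real
  assumes g: "g = (1 + sqrt 5) / 2"
begin

section \<open>Approximate scaling of Fibonacci numbers\<close>

lemma g_sq: "g * g = g + 1"
  unfolding g by (simp add: field_simps)

lemma g_bounds: "8 / 5 \<le> g" "g \<le> 13 / 8"
proof -
  have "11 / 5 \<le> sqrt 5" by (rule real_le_rsqrt) (simp add: power2_eq_square)
  moreover have "sqrt 5 \<le> 9 / 4" by (rule real_le_lsqrt) (simp_all add: power2_eq_square)
  ultimately show "8 / 5 \<le> g" "g \<le> 13 / 8" unfolding g by simp_all
qed

text \<open>The number \<open>1 - g\<close> is the other root of \<open>z * z = z + 1\<close>, so
  the left side is multiplied by it when \<open>n\<close> grows by one.\<close>

lemma F_shift: "real (F (Suc n)) - g * real (F n) = (1 - g) ^ Suc n"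
proof (induction n)
  case (Suc n)
  have "real (F (Suc (Suc n))) - g * real (F (Suc n)) = (1 - g) * (real (F (Suc n)) - g * real (F n))"
    using g_sq by (simp add: algebra_simps flip: mult.assoc)
  thus ?case using Suc by simp
qed simp

lemma F_shift_abs: "\<bar>real (F (Suc n)) - g * real (F n)\<bar> = (g - 1) ^ Suc n"
  unfolding F_shift power_abs using g_bounds by simp

text \<open>Moving the scaled point to \<open>(s', t')\<close> costs \<open>72 * d\<close> by the
  Lipschitz bound; comparing the two formulas costs \<open>72 * d + 32 * d\<close>.\<close>

lemma compare_affine:
  assumes "0 \<le> s" "t \<le> s" "0 \<le> s'" "t' \<le> s'" "\<bar>g * s - s'\<bar> \<le> 72 * d" "\<bar>g * t - t'\<bar> \<le> 72 * d"
    and P: "P_comp k s t = sorted3 k (s - a) (t - b) c" and P': "P_comp k s' t' = sorted3 k (s' - a') (t' - b') c'"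
    and "\<bar>g * a - a'\<bar> \<le> 32 * d" "\<bar>g * b - b'\<bar> \<le> 32 * d" "\<bar>g * c - c'\<bar> \<le> 32 * d"
  shows "\<bar>P_comp k (g * s) (g * t) - g * P_comp k s t\<bar> \<le> 176 * d"
proof -
  have "g * t \<le> g * s" using assms g_bounds by (intro mult_left_mono) auto
  hence "\<bar>P_comp k (g * s) (g * t) - P_comp k s' t'\<bar> \<le> 72 * d"
    using assms g_bounds by (intro P_comp_lipschitz) auto
  moreover have "\<bar>sorted3 k (s' - a') (t' - b') c' - sorted3 k (g * (s - a)) (g * (t - b)) (g * c)\<bar> \<le> 104 * d"
    using assms by (intro sorted3_lipschitz) (auto simp: algebra_simps)
  ultimately show ?thesis unfolding P P' using sorted3_mult[of g k] g_bounds by simp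
qed

lemma scaling_step_affine:
  fixes j x y :: nat
  assumes x: "x = F (j + 1)" and y: "y = F j"
    and st: "4 * real x + 2 * real y \<le> s" "s \<le> 6 * real x + 4 * real y" "t \<le> s"
    and ABCE: "s - t \<le> 2 * real x \<or> 4 * real x + 2 * real y \<le> t"
  shows "\<bar>P_comp k (g * s) (g * t) - g * P_comp k s t\<bar> \<le> 22 * (g - 1) ^ Suc j"
proof -
  \<comment> \<open>With this unit the error of \<open>x\<close> against \<open>g * y\<close> is
    \<open>8 * d\<close>, and since \<open>g - 1 \<le> 5 / 8\<close> that of \<open>x + y\<close>
    against \<open>g * x\<close> is at most \<open>5 * d\<close>.\<close>
  define d where "d = (g - 1) ^ Suc j / 8"
  define X Y Z :: real where "X = real x" and "Y = real y" and "Z = X + Y"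
  have d: "0 \<le> d" unfolding d_def using g_bounds by simp
  have e_def: "(g - 1) ^ Suc j = 8 * d" unfolding d_def by simp
  have "\<bar>X - g * Y\<bar> = 8 * d" using F_shift_abs[of j] unfolding e_def by (simp add: X_def Y_def x y)
  hence e2: "X - g * Y \<le> 8 * d" "g * Y - X \<le> 8 * d" by linarith+
  have "\<bar>X + Y - g * X\<bar> = (g - 1) * (8 * d)"
    using F_shift_abs[of "Suc j"] unfolding power_Suc[of _ "Suc j"] e_def by (simp add: X_def Y_def x y)
  moreover have "(g - 1) * (8 * d) \<le> 5 / 8 * (8 * d)" using d g_bounds by (intro mult_right_mono) auto
  ultimately have e1: "Z - g * X \<le> 5 * d" "g * X - Z \<le> 5 * d" by (auto simp: abs_le_iff Z_def)
  have xy': "x + y = F (Suc j + 1)" "x = F (Suc j)" by (simp_all add: x y)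
  have XY: "0 < Y" "Y \<le> X" "X \<le> 2 * Y" "Z = X + Y" using xy_reals[OF x y] by (simp_all add: X_def Y_def Z_def)
  have XY': "real (x + y) = Z" by (simp add: X_def Y_def Z_def)
  note fold = X_def[symmetric] Y_def[symmetric]
  note st = st[unfolded fold] and ABCE = ABCE[unfolded fold]
  note PA = P_comp_near_low[OF x y, unfolded fold] and PB = P_comp_near_mid[OF x y, unfolded fold]
    and PC = P_comp_near_high[OF x y, unfolded fold] and PE = P_comp_far_high[OF x y, unfolded fold]
  note PA' = P_comp_near_low[OF xy', unfolded XY' fold] and PB' = P_comp_near_mid[OF xy', unfolded XY' fold]
    and PC' = P_comp_near_high[OF xy', unfolded XY' fold] and PE' = P_comp_far_high[OF xy', unfolded XY' fold]
  have le: "g * a \<le> g * b" if "a \<le> b" for a b using that g_bounds by (intro mult_left_mono) auto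
  have s0: "0 \<le> s" using st XY by linarith
  consider (A) "s - t \<le> 2 * X" "t \<le> 4 * X"
    | (B) "s - t \<le> 2 * X" "4 * X \<le> t" "t \<le> 4 * X + 2 * Y"
    | (C) "s - t \<le> 2 * X" "4 * X + 2 * Y \<le> t"
    | (E) "2 * X \<le> s - t" "4 * X + 2 * Y \<le> t" using ABCE by linarith
  hence "\<bar>P_comp k (g * s) (g * t) - g * P_comp k s t\<bar> \<le> 176 * d"
  proof cases
    case A
    \<comment> \<open>This comes from \<open>t \<ge> s - 2 * X\<close>. The analogous bound on
      \<open>t'\<close> makes the range for \<open>s'\<close> nonempty.\<close>
    have g1: "2 * (g * X) + 2 * (g * Y) \<le> g * t" using le[of "2 * X + 2 * Y" t] A st by (simp add: algebra_simps)
    have g2: "g * t \<le> 4 * (g * X)" using le[of t "4 * X"] A by (simp add: algebra_simps)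
    have g3: "4 * (g * X) + 2 * (g * Y) \<le> g * s" using le[OF st(1)] by (simp add: algebra_simps)
    have g4: "g * s \<le> g * t + 2 * (g * X)" using le[of s "t + 2 * X"] A by (simp add: algebra_simps)
    have "\<exists>t'. 2 * Z + 2 * X \<le> t' \<and> t' \<le> 4 * Z \<and> \<bar>g * t - t'\<bar> \<le> 40 * d"
      by (rule clamp) (use g1 g2 e1 e2 d XY in linarith)+
    then obtain t' where t': "2 * Z + 2 * X \<le> t'" "t' \<le> 4 * Z" "\<bar>g * t - t'\<bar> \<le> 40 * d" by blast
    have "\<exists>s'. 4 * Z + 2 * X \<le> s' \<and> s' \<le> t' + 2 * Z \<and> \<bar>g * s - s'\<bar> \<le> 72 * d"
      by (rule clamp) (use g3 g4 e1 e2 d XY t' in linarith)+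
    then obtain s' where s': "4 * Z + 2 * X \<le> s'" "s' \<le> t' + 2 * Z" "\<bar>g * s - s'\<bar> \<le> 72 * d" by blast
    show ?thesis
      by (rule compare_affine[where a = "2 * X + Y" and b = "X - Y" and c = "3 * X"
          and a' = "2 * Z + X" and b' = "Z - X" and c' = "3 * Z", OF s0 st(3) _ _ s'(3)])
        (use PA[of s t k] PA'[of s' t' k] A st s' t' d e1 e2 XY in \<open>simp_all add: algebra_simps abs_le_iff\<close>)
  next
    case B
    have g1: "4 * (g * X) \<le> g * t" using le[OF B(2)] by (simp add: algebra_simps)
    have g2: "g * t \<le> 4 * (g * X) + 2 * (g * Y)" using le[OF B(3)] by (simp add: algebra_simps)
    have g3: "4 * (g * X) + 2 * (g * Y) \<le> g * s" using le[OF st(1)] by (simp add: algebra_simps)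
    have g4: "g * s \<le> g * t + 2 * (g * X)" using le[of s "t + 2 * X"] B by (simp add: algebra_simps)
    have "\<exists>t'. 4 * Z \<le> t' \<and> t' \<le> 4 * Z + 2 * X \<and> \<bar>g * t - t'\<bar> \<le> 40 * d"
      by (rule clamp) (use g1 g2 e1 e2 d XY in linarith)+
    then obtain t' where t': "4 * Z \<le> t'" "t' \<le> 4 * Z + 2 * X" "\<bar>g * t - t'\<bar> \<le> 40 * d" by blast
    have "\<exists>s'. 4 * Z + 2 * X \<le> s' \<and> s' \<le> t' + 2 * Z \<and> \<bar>g * s - s'\<bar> \<le> 72 * d"
      by (rule clamp) (use g3 g4 e1 e2 d XY t' in linarith)+
    then obtain s' where s': "4 * Z + 2 * X \<le> s'" "s' \<le> t' + 2 * Z" "\<bar>g * s - s'\<bar> \<le> 72 * d" by blast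
    show ?thesis
      by (rule compare_affine[where a = "2 * X + Y" and b = "X" and c = "3 * X + Y"
          and a' = "2 * Z + X" and b' = "Z" and c' = "3 * Z + X", OF s0 st(3) _ _ s'(3)])
        (use PB[of s t k] PB'[of s' t' k] B st s' t' d e1 e2 XY in \<open>simp_all add: algebra_simps abs_le_iff\<close>)
  next
    case C
    have g1: "4 * (g * X) + 2 * (g * Y) \<le> g * t" using le[OF C(2)] by (simp add: algebra_simps)
    have g2: "g * s \<le> 6 * (g * X) + 4 * (g * Y)" using le[OF st(2)] by (simp add: algebra_simps)
    have g3: "g * t \<le> g * s" using le[OF st(3)] .
    have g4: "g * s \<le> g * t + 2 * (g * X)" using le[of s "t + 2 * X"] C by (simp add: algebra_simps)
    \<comment> \<open>The limit \<open>6 * X + 4 * Y\<close> contributes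
      \<open>6 * 5 + 4 * 8 = 62\<close>; the constraint on \<open>s - t\<close> adds 10 and gives
      the 72 for \<open>s'\<close>.\<close>
    have "\<exists>t'. 4 * Z + 2 * X \<le> t' \<and> t' \<le> 6 * Z + 4 * X \<and> \<bar>g * t - t'\<bar> \<le> 62 * d"
      by (rule clamp) (use g1 g2 g3 e1 e2 d XY in linarith)+
    then obtain t' where t': "4 * Z + 2 * X \<le> t'" "t' \<le> 6 * Z + 4 * X" "\<bar>g * t - t'\<bar> \<le> 62 * d" by blast
    have "\<exists>s'. t' \<le> s' \<and> s' \<le> min (t' + 2 * Z) (6 * Z + 4 * X) \<and> \<bar>g * s - s'\<bar> \<le> 72 * d"
    proof (rule clamp)
      show "t' \<le> g * s + 72 * d" using g3 t' d by linarith
      have "g * s \<le> t' + 2 * Z + 72 * d" using g4 t' e1 d by linarith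
      moreover have "g * s \<le> 6 * Z + 4 * X + 72 * d" using g2 e1 e2 d by linarith
      ultimately show "g * s \<le> min (t' + 2 * Z) (6 * Z + 4 * X) + 72 * d" by simp
    qed (use t' XY d in auto)
    then obtain s' where s': "t' \<le> s'" "s' \<le> min (t' + 2 * Z) (6 * Z + 4 * X)" "\<bar>g * s - s'\<bar> \<le> 72 * d" by blast
    show ?thesis
      by (rule compare_affine[where a = "2 * X + Y" and b = "X + Y" and c = "3 * X + 2 * Y"
          and a' = "2 * Z + X" and b' = "Z + X" and c' = "3 * Z + 2 * X", OF s0 st(3) _ _ s'(3)])
        (use PC[of t s k] PC'[of t' s' k] C st s' t' d e1 e2 XY in \<open>simp_all add: algebra_simps abs_le_iff\<close>)
  next
    case E
    have g1: "4 * (g * X) + 2 * (g * Y) \<le> g * t" using le[OF E(2)] by (simp add: algebra_simps)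
    have g2: "g * s \<le> 6 * (g * X) + 4 * (g * Y)" using le[OF st(2)] by (simp add: algebra_simps)
    have g3: "g * t + 2 * (g * X) \<le> g * s" using le[of "t + 2 * X" s] E by (simp add: algebra_simps)
    have "\<exists>t'. 4 * Z + 2 * X \<le> t' \<and> t' \<le> 4 * Z + 4 * X \<and> \<bar>g * t - t'\<bar> \<le> 56 * d"
      by (rule clamp) (use g1 g2 g3 e1 e2 d XY in linarith)+
    then obtain t' where t': "4 * Z + 2 * X \<le> t'" "t' \<le> 4 * Z + 4 * X" "\<bar>g * t - t'\<bar> \<le> 56 * d" by blast
    have "\<exists>s'. t' + 2 * Z \<le> s' \<and> s' \<le> 6 * Z + 4 * X \<and> \<bar>g * s - s'\<bar> \<le> 72 * d"
      by (rule clamp) (use g1 g2 g3 e1 e2 d XY t' in linarith)+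
    then obtain s' where s': "t' + 2 * Z \<le> s'" "s' \<le> 6 * Z + 4 * X" "\<bar>g * s - s'\<bar> \<le> 72 * d" by blast
    show ?thesis
      by (rule compare_affine[where a = "3 * X + Y" and b = "Y" and c = "3 * X + 2 * Y"
          and a' = "3 * Z + X" and b' = "X" and c' = "3 * Z + 2 * X", OF s0 st(3) _ _ s'(3)])
        (use PE[of t s k] PE'[of t' s' k] E st s' t' d e1 e2 XY in \<open>simp_all add: algebra_simps abs_le_iff\<close>)
  qed
  thus ?thesis unfolding e_def by simp
qed

text \<open>The errors are \<open>62 * d\<close> for moving to \<open>(s', t')\<close>,
  \<open>82 * d\<close> between the reduced points, and \<open>10 * d\<close> between
  \<open>2 * Z\<close> and \<open>2 * (g * X)\<close>: together less than
  \<open>160 * d\<close>.\<close>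

lemma scaling_step_recursive:
  fixes j x y :: nat
  assumes x: "x = F (j + 1)" and y: "y = F j"
    and st: "4 * real x + 2 * real y \<le> s" "s \<le> 6 * real x + 4 * real y"
    and R: "2 * real x \<le> s - t" "t \<le> 4 * real x + 2 * real y"
    and IH: "\<bar>P_comp k (g * (s - 4 * real x)) (g * (t - 2 * real x)) - g * P_comp k (s - 4 * real x) (t - 2 * real x)\<bar> \<le> K"
  shows "\<bar>P_comp k (g * s) (g * t) - g * P_comp k s t\<bar> \<le> K + 20 * (g - 1) ^ Suc j"
proof -
  define d where "d = (g - 1) ^ Suc j / 8"
  define X Y Z :: real where "X = real x" and "Y = real y" and "Z = X + Y"
  have d: "0 \<le> d" unfolding d_def using g_bounds by simp
  have e_def: "(g - 1) ^ Suc j = 8 * d" unfolding d_def by simp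
  have "\<bar>X - g * Y\<bar> = 8 * d" using F_shift_abs[of j] unfolding e_def by (simp add: X_def Y_def x y)
  hence e2: "X - g * Y \<le> 8 * d" "g * Y - X \<le> 8 * d" by linarith+
  have "\<bar>X + Y - g * X\<bar> = (g - 1) * (8 * d)"
    using F_shift_abs[of "Suc j"] unfolding power_Suc[of _ "Suc j"] e_def by (simp add: X_def Y_def x y)
  moreover have "(g - 1) * (8 * d) \<le> 5 / 8 * (8 * d)" using d g_bounds by (intro mult_right_mono) auto
  ultimately have e1: "Z - g * X \<le> 5 * d" "g * X - Z \<le> 5 * d" by (auto simp: abs_le_iff Z_def)
  have xy': "x + y = F (Suc j + 1)" "x = F (Suc j)" by (simp_all add: x y)
  have XY: "0 < Y" "Y \<le> X" "X \<le> 2 * Y" "Z = X + Y" using xy_reals[OF x y] by (simp_all add: X_def Y_def Z_def)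
  have XY': "real (x + y) = Z" by (simp add: X_def Y_def Z_def)
  note fold = X_def[symmetric] Y_def[symmetric]
  note st = st[unfolded fold] and R = R[unfolded fold] and IH = IH[unfolded fold]
  have le: "g * a \<le> g * b" if "a \<le> b" for a b using that g_bounds by (intro mult_left_mono) auto
  have g1: "g * t \<le> 4 * (g * X) + 2 * (g * Y)" using le[OF R(2)] by (simp add: algebra_simps)
  have g2: "4 * (g * X) + 2 * (g * Y) \<le> g * s" using le[OF st(1)] by (simp add: algebra_simps)
  have g3: "g * s \<le> 6 * (g * X) + 4 * (g * Y)" using le[OF st(2)] by (simp add: algebra_simps)
  have g4: "g * t + 2 * (g * X) \<le> g * s" using le[of "t + 2 * X" s] R by (simp add: algebra_simps)
  \<comment> \<open>In this polygon \<open>t\<close> is unbounded below, so it only has to be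
    capped.\<close>
  obtain t' where t': "t' \<le> 4 * Z + 2 * X" "\<bar>g * t - t'\<bar> \<le> 36 * d" "t' \<le> g * t"
    by (rule that[of "min (g * t) (4 * Z + 2 * X)"]) (use g1 e1 e2 d in \<open>auto simp: min_def abs_le_iff\<close>)
  have "\<exists>s'. max (4 * Z + 2 * X) (t' + 2 * Z) \<le> s' \<and> s' \<le> 6 * Z + 4 * X \<and> \<bar>g * s - s'\<bar> \<le> 62 * d"
  proof (rule clamp)
    have "4 * Z + 2 * X \<le> g * s + 62 * d" using g2 e1 e2 d by linarith
    moreover have "t' + 2 * Z \<le> g * s + 62 * d" using g4 t' e1 d by linarith
    ultimately show "max (4 * Z + 2 * X) (t' + 2 * Z) \<le> g * s + 62 * d" by simp
    show "g * s \<le> 6 * Z + 4 * X + 62 * d" using g3 e1 e2 d by linarith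
  qed (use t' XY d in auto)
  then obtain s' where s': "max (4 * Z + 2 * X) (t' + 2 * Z) \<le> s'" "s' \<le> 6 * Z + 4 * X" "\<bar>g * s - s'\<bar> \<le> 62 * d" by blast
  have "P_comp k s t = P_comp k (s - 4 * X) (t - 2 * X) + 2 * X"
    using P_comp_far_low[OF x y, unfolded fold] st R by blast
  moreover have "P_comp k s' t' = P_comp k (s' - 4 * Z) (t' - 2 * Z) + 2 * Z"
    using s' t' by (intro P_comp_far_low[OF xy', unfolded XY' fold]) auto
  moreover have "\<bar>P_comp k (g * s) (g * t) - P_comp k s' t'\<bar> \<le> 62 * d"
    using s' t' XY g1 g2 g3 g4 d le[of 0 X] le[of 0 Y] by (intro P_comp_lipschitz) (auto simp: abs_le_iff)
  moreover have "\<bar>P_comp k (s' - 4 * Z) (t' - 2 * Z) - P_comp k (g * (s - 4 * X)) (g * (t - 2 * X))\<bar> \<le> 62 * d + 20 * d"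
  proof (rule P_comp_lipschitz)
    show "0 \<le> g * (s - 4 * X)" using le[of 0 "s - 4 * X"] st XY by simp
    show "g * (t - 2 * X) \<le> g * (s - 4 * X)" using R by (intro le) simp
    have "\<bar>s' - g * s\<bar> \<le> 62 * d" "\<bar>t' - g * t\<bar> \<le> 62 * d" using s' t' d by linarith+
    thus "\<bar>s' - 4 * Z - g * (s - 4 * X)\<bar> \<le> 62 * d + 20 * d"
      "\<bar>t' - 2 * Z - g * (t - 2 * X)\<bar> \<le> 62 * d + 20 * d"
      using e1 d by (simp_all add: algebra_simps abs_le_iff)
  qed (use s' XY in auto)
  ultimately show ?thesis unfolding e_def using IH e1 d
    by (simp add: algebra_simps abs_le_iff)
qed

text \<open>The form of the bound makes the geometric series telescope: for \<open>h = g - 1\<close>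
  one has \<open>h ^ j - h ^ (j + 2) = h ^ (j + 1)\<close>, so the error added by the recursive
  polygon is absorbed exactly.\<close>

lemma P_comp_scaling_bound:
  assumes "0 \<le> s" "t \<le> s" "s < 2 * real (F (j + 4))"
  shows "\<bar>P_comp k (g * s) (g * t) - g * P_comp k s t\<bar> \<le> 40 - 20 * (g - 1) ^ j"
  using assms
proof (induction j arbitrary: s t)
  case 0
  have F4: "alpha_len 5 = 5" "alpha_len 13 = 13" using alpha_len_F[of 4] alpha_len_F[of 6] by (simp_all add: numeral_eq_Suc)
  have s: "s < 10" using 0 by (simp add: numeral_eq_Suc)
  have "g * s \<le> 13 / 8 * 10" using g_bounds s 0 by (intro mult_mono) auto
  moreover have gs: "0 \<le> g * s" "g * t \<le> g * s" using g_bounds 0 by auto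
  \<comment> \<open>Here \<open>g * s\<close> is below 26, so the fixed lengths 0, 5, 13 bracket it
    with width at most 8. Adding \<open>13 / 8 * 5\<close> for the unscaled point stays below
    20.\<close>
  ultimately have "\<bar>P_comp k (g * s) (g * t) - sorted3 k (g * s / 2) (g * t) (g * s / 2)\<bar> \<le> 8"
    using P_comp_near_center[of 0 "g * s" 5 "g * t" k] P_comp_near_center[of 5 "g * s" 13 "g * t" k] F4
    by (cases "g * s < 10") auto
  moreover have "\<bar>P_comp k s t - sorted3 k (s / 2) t (s / 2)\<bar> \<le> 5"
    using P_comp_near_center[of 0 s 5 t k] F4 s 0 by simp
  hence "\<bar>g * (P_comp k s t - sorted3 k (s / 2) t (s / 2))\<bar> \<le> 13 / 8 * 5"
    unfolding abs_mult using g_bounds by (intro mult_mono) auto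
  moreover have "g * sorted3 k (s / 2) t (s / 2) = sorted3 k (g * s / 2) (g * t) (g * s / 2)"
    using sorted3_mult[of g k "s / 2" t "s / 2"] g_bounds by simp
  ultimately show ?case unfolding right_diff_distrib abs_le_iff by simp
next
  case (Suc j)
  define x y where xy: "x = F (Suc j + 1)" "y = F (Suc j)"
  note F = F_eqs[OF xy] and xyr = xy_reals[OF xy]
  have F4: "real (F (Suc j + 4)) = 3 * real x + 2 * real y" using F(3) by simp
  have F3: "real (F (j + 4)) = 2 * real x + real y" using F(2) by (simp add: numeral_eq_Suc)
  define h where "h = g - 1"
  have h: "0 < h" "h \<le> 5 / 8" "h * h = 1 - h" using g_bounds g_sq by (simp_all add: h_def algebra_simps)
  have hj: "0 \<le> h ^ j" "0 \<le> h ^ Suc j" "h ^ j \<le> 1" using h by (simp_all add: power_le_one)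
  have hh: "h ^ Suc (Suc j) = h ^ j - h ^ Suc j" 
  proof -
    have "h ^ Suc (Suc j) = (h * h) * h ^ j" by simp
    thus ?thesis unfolding h(3) by (simp add: left_diff_distrib)
  qed
  have h1: "h ^ Suc j \<le> 5 / 8 * h ^ j" using h hj by (simp add: mult_right_mono)
  show ?case
  proof (cases "s < 2 * real (F (j + 4))")
    case True
    from Suc.IH[OF Suc.prems(1,2) True] h1 hj show ?thesis by (simp add: h_def)
  next
    case False
    hence s: "4 * real x + 2 * real y \<le> s" "s \<le> 6 * real x + 4 * real y" "s < 6 * real x + 4 * real y"
      using F3 F4 Suc.prems by auto
    show ?thesis
    proof (cases "s - t \<le> 2 * real x \<or> 4 * real x + 2 * real y \<le> t")
      case True
      from scaling_step_affine[OF xy s(1,2) Suc.prems(2) True, of k]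
      have "\<bar>P_comp k (g * s) (g * t) - g * P_comp k s t\<bar> \<le> 22 * h ^ Suc (Suc j)" by (simp only: h_def)
      thus ?thesis unfolding hh h_def[symmetric] right_diff_distrib using hj by linarith
    next
      case False
      have "\<bar>P_comp k (g * (s - 4 * real x)) (g * (t - 2 * real x)) - g * P_comp k (s - 4 * real x) (t - 2 * real x)\<bar> \<le> 40 - 20 * (g - 1) ^ j"
        \<comment> \<open>The reduced first coordinate is below \<open>2 * x + 4 * y\<close>, which
          is at most \<open>2 * F (j + 4)\<close>.\<close>
        using s False xyr F3 by (intro Suc.IH) auto
      from scaling_step_recursive[OF xy s(1,2) _ _ this] False
      have "\<bar>P_comp k (g * s) (g * t) - g * P_comp k s t\<bar> \<le> 40 - 20 * h ^ j + 20 * h ^ Suc (Suc j)"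
        by (simp add: h_def)
      thus ?thesis unfolding hh h_def[symmetric] right_diff_distrib by linarith
    qed
  qed
qed

lemma P_comp_scaling:
  assumes "0 \<le> s" "t \<le> s"
  shows "\<bar>P_comp k (g * s) (g * t) - g * P_comp k s t\<bar> \<le> 40"
proof -
  define j where "j = nat \<lceil>s\<rceil>"
  have "s \<le> real j" unfolding j_def by linarith
  also have "real j < real (F (j + 4))" using F_ge[of "j + 4"] by linarith
  finally have "s < 2 * real (F (j + 4))" using assms by linarith
  moreover have "0 \<le> (g - 1) ^ j" using g_bounds by simp
  ultimately show ?thesis using P_comp_scaling_bound[OF assms, of j k] by linarith
qed

end

section \<open>Back to words and vectors\<close>

lemma A_region_iff:
  "q \<in> A_region (winf_prefix n) \<longleftrightarrow> in_A (q $ 1) (q $ 2) n"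
  unfolding A_region_def P_word_def in_A_def alpha_len_def[symmetric] by (auto simp: max_def)

lemma C_region_iff:
  "q \<in> C_region (winf_prefix n) \<longleftrightarrow> in_C (q $ 1) (q $ 2) n"
  unfolding C_region_def P_word_def in_C_def alpha_len_def[symmetric] by (auto simp: max_def)

lemma u_word_state:
  assumes "state (q $ 1) (q $ 2) n m"
  shows "u_word q = winf_prefix n"
  unfolding u_word_def
proof (rule the_equality)
  have *: "prefix v (winf_prefix n)" if "v \<in> winf_prefixes" "q \<in> A_region v" for v
  proof -
    obtain k where v: "v = winf_prefix k" using \<open>v \<in> winf_prefixes\<close> winf_prefixes_iff by blast
    have "k \<le> n" using that assms by (auto simp: v A_region_iff state_def not_less[symmetric])
    thus ?thesis by (simp add: v)
  qed
  have A: "q \<in> A_region (winf_prefix n)" using assms by (simp add: A_region_iff state_def)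
  with * show "winf_prefix n \<in> winf_prefixes \<and> q \<in> A_region (winf_prefix n) \<and> (\<forall>v\<in>winf_prefixes. q \<in> A_region v \<longrightarrow> prefix v (winf_prefix n))"
    by simp
  fix u assume "u \<in> winf_prefixes \<and> q \<in> A_region u \<and> (\<forall>v\<in>winf_prefixes. q \<in> A_region v \<longrightarrow> prefix v u)"
  with * A show "u = winf_prefix n" by (intro prefix_order.antisym) auto
qed

lemma w_word_state:
  assumes "state (q $ 1) (q $ 2) n m"
  shows "w_word q = winf_prefix m"
  unfolding w_word_def u_word_state[OF assms]
proof (rule the_equality)
  have *: "prefix (winf_prefix m) v" if "v \<in> winf_prefixes" "strict_prefix (winf_prefix n) v" "q \<in> C_region v" for v
  proof -
    obtain k where v: "v = winf_prefix k" using \<open>v \<in> winf_prefixes\<close> winf_prefixes_iff by blast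
    have "m \<le> k" using that assms by (auto simp: v C_region_iff state_def not_less[symmetric])
    thus ?thesis by (simp add: v)
  qed
  have C: "q \<in> C_region (winf_prefix m)" "n < m" using assms by (simp_all add: C_region_iff state_def)
  with * show "winf_prefix m \<in> winf_prefixes \<and> strict_prefix (winf_prefix n) (winf_prefix m) \<and> q \<in> C_region (winf_prefix m) \<and>
      (\<forall>v\<in>winf_prefixes. strict_prefix (winf_prefix n) v \<and> q \<in> C_region v \<longrightarrow> prefix (winf_prefix m) v)"
    by simp
  fix w assume "w \<in> winf_prefixes \<and> strict_prefix (winf_prefix n) w \<and> q \<in> C_region w \<and>
      (\<forall>v\<in>winf_prefixes. strict_prefix (winf_prefix n) v \<and> q \<in> C_region v \<longrightarrow> prefix w v)"
  with * C show "w = winf_prefix m" by (intro prefix_order.antisym) auto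
qed

lemma Phi_sorted3:
  "Phi (vector [a, b, c]) $ 1 = sorted3 0 a b c"
  "Phi (vector [a, b, c]) $ 2 = sorted3 1 a b c"
  "Phi (vector [a, b, c]) $ 3 = sorted3 2 a b c"
  by (auto simp: Phi_def sorted3_def vector_3 min_def max_def)

lemma P_map_components:
  assumes "0 \<le> q $ 1" "q $ 2 \<le> q $ 1"
  shows "P_map q $ 1 = P_comp 0 (q $ 1) (q $ 2)" "P_map q $ 2 = P_comp 1 (q $ 1) (q $ 2)"
    "P_map q $ 3 = P_comp 2 (q $ 1) (q $ 2)"
proof -
  from state_exists[OF assms] obtain n m where nm: "state (q $ 1) (q $ 2) n m" .
  show "P_map q $ 1 = P_comp 0 (q $ 1) (q $ 2)" "P_map q $ 2 = P_comp 1 (q $ 1) (q $ 2)"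
    "P_map q $ 3 = P_comp 2 (q $ 1) (q $ 2)"
    unfolding P_map_def u_word_state[OF nm] w_word_state[OF nm] P_comp_state[OF nm] Phi_sorted3 by simp_all
qed

lemma infnorm_le_3:
  fixes v :: "real^3"
  assumes "\<bar>v $ 1\<bar> \<le> c" "\<bar>v $ 2\<bar> \<le> c" "\<bar>v $ 3\<bar> \<le> c"
  shows "infnorm v \<le> c"
proof -
  have "\<bar>v $ i\<bar> \<le> c" for i using assms exhaust_3[of i] by auto
  thus ?thesis unfolding infnorm_cart by (intro cSup_least) auto
qed

theorem theorem3p2:
  fixes \<gamma> :: real
  assumes "\<gamma> = (1 + sqrt 5) / 2"
  shows "A_region [] = {q :: real^2. q $ 1 \<ge> 0 \<and> q $ 2 \<le> q $ 1} \<and>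
    (\<forall>q\<in>A_region []. infnorm (P_map (\<gamma> *\<^sub>R q) - \<gamma> *\<^sub>R P_map q) \<le> 40)"
proof -
  have A: "q \<in> A_region [] \<longleftrightarrow> q $ 1 \<ge> 0 \<and> q $ 2 \<le> q $ 1" for q
    using A_region_iff[of q 0] by (simp add: in_A_def)
  moreover have "infnorm (P_map (\<gamma> *\<^sub>R q) - \<gamma> *\<^sub>R P_map q) \<le> 40" if "q \<in> A_region []" for q
  proof -
    have q: "0 \<le> q $ 1" "q $ 2 \<le> q $ 1" using that A by auto
    have "0 \<le> \<gamma>" using g_bounds[OF assms] by simp
    hence "0 \<le> (\<gamma> *\<^sub>R q) $ 1" "(\<gamma> *\<^sub>R q) $ 2 \<le> (\<gamma> *\<^sub>R q) $ 1"
      using q by (auto intro: mult_left_mono)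
    note P_comp = P_map_components[OF q] P_map_components[OF this]
    show ?thesis using P_comp_scaling[OF assms q] by (intro infnorm_le_3) (simp_all add: P_comp)
  qed
  ultimately show ?thesis by auto
qed

end
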